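(* Let $q>0$ be a real number. The diagram formed by $B_q^{-1}:ML_q(\mathbb{C})\to L^2(\mathbb{R})$, $\mathcal{F}:L^2(\mathbb{R})\to L^2(\mathbb{R})$, $B_q:L^2(\mathbb{R})\to ML_q(\mathbb{C})$ and $S_q:ML_q(\mathbb{C})\to ML_q(\mathbb{C})$ is commutative, so that the composition operator $$S_q=B_q\circ\mathcal{F}\circ B_q^{-1}$$ is well defined. More precisely, for every $f\in ML_q(\mathbb{C})$ it holds that $$S_q(f)(z)=-f(-iz),\qquad\forall z\in\mathbb{C}.$$
   Context: $L^2(\mathbb{R})$ is the space of complex-valued square integrable functions on $\mathbb{R}$, with inner product $\langle\phi,\psi\rangle_{L^2(\mathbb{R})}=\int_{\mathbb{R}}\phi(t)\overline{\psi(t)}\,dt$. $\mathcal{F}$ is the Fourier transform on $L^2(\mathbb{R})$, $\mathcal{F}(f)(\lambda)=\frac{1}{\sqrt{2\pi}}\int_{\mathbb{R}}e^{-i\lambda x}f(x)\,dx$. The normalized Hermite functions $\psi_n$, $n\ge 0$, are $\psi_n(x)=(2^n n!\sqrt{\pi})^{-1/2}H_n(x)e^{-x^2/2}$ with $H_n$ the (physicists') Hermite polynomials; they form an orthonormal basis of $L^2(\mathbb{R})$. For $q>0$ the Mittag-Leffler Fock space $ML_q(\mathbb{C})$ is the Hilbert space of entire functions $f(z)=\sum_{n=0}^\infty a_nz^n$ with $\|f\|^2_{ML_q(\mathbb{C})}=\sum_{n=0}^\infty\Gamma(qn+1)|a_n|^2<\infty$; its reproducing kernel is $K_q(z,w)=\sum_{n=0}^\infty\frac{(z\overline{w})^n}{\Gamma(qn+1)}$.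 The ML-Bargmann kernel is $$A_q(z,x)=\sum_{n=0}^\infty\frac{\overline{z}^{\,n}}{\sqrt{\Gamma(qn+1)}}\psi_n(x),\qquad z\in\mathbb{C},\ x\in\mathbb{R},$$ and the Mittag-Leffler Bargmann (MLB) transform is $$B_q(\phi)(z)=\int_{\mathbb{R}}\overline{A_q(z,x)}\,\phi(x)\,dx,\qquad \phi\in L^2(\mathbb{R}),\ z\in\mathbb{C}.$$ It is an isometric isomorphism of $L^2(\mathbb{R})$ onto $ML_q(\mathbb{C})$, with inverse $B_q^{-1}:ML_q(\mathbb{C})\to L^2(\mathbb{R})$.
   Formalization: The formula is corrected to S_q(f)(z) = f(-iz): the printed S_q(f)(z) = -f(-iz) fails for f = 1, since the Gaussian ψ_0 is fixed by the Fourier transform and B_q(ψ_0) = 1, so S_q(1) = 1. *)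

theory Defs
  imports "HOL-Analysis.Analysis"
begin

definition square_integrable :: "(real \<Rightarrow> complex) \<Rightarrow> bool" where
  "square_integrable f \<longleftrightarrow>
     f \<in> borel_measurable lborel \<and> integrable lborel (\<lambda>x. (cmod (f x))\<^sup>2)"

definition L2_eq :: "(real \<Rightarrow> complex) \<Rightarrow> (real \<Rightarrow> complex) \<Rightarrow> bool" where
  "L2_eq f g \<longleftrightarrow> square_integrable f \<and> square_integrable g \<and> (AE x in lborel. f x = g x)"

text \<open>The elements of \<open>L2\<close> are classes of functions modulo equality almost everywhere, so that
  the inverse of the transform below is the inverse of an honest bijection.\<close>

quotient_type L2 = "real \<Rightarrow> complex" / partial: L2_eq
proof (rule part_equivpI)
  show "\<exists>f. L2_eq f f"
    by (rule exI[of _ "\<lambda>_. 0"]) (simp add: L2_eq_def square_integrable_def)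
  show "symp L2_eq"
    by (rule sympI) (auto simp: L2_eq_def elim: AE_mp)
  show "transp L2_eq"
  proof (rule transpI)
    fix f g h assume "L2_eq f g" "L2_eq g h"
    moreover from this have "AE x in lborel. f x = h x"
      unfolding L2_eq_def by (auto elim: eventually_elim2)
    ultimately show "L2_eq f h" by (simp add: L2_eq_def)
  qed
qed

definition fourier_integral :: "(real \<Rightarrow> complex) \<Rightarrow> real \<Rightarrow> complex" where
  "fourier_integral f \<xi> =
     complex_of_real (1 / sqrt (2 * pi)) * (LINT x|lborel. exp (- \<i> * of_real (\<xi> * x)) * f x)"

text \<open>For a square integrable function that is not integrable, the Fourier integral is understood
  in the sense of Plancherel: it is the limit in mean square of the integrals over \<open>[-R, R]\<close>
  as \<open>R\<close> tends to infinity. The value does not depend on the representative \<open>rep_L2 \<phi>\<close>.\<close>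

definition fourier_L2 :: "L2 \<Rightarrow> L2" where
  "fourier_L2 \<phi> = (THE \<psi>.
     ((\<lambda>R. \<integral>\<^sup>+ \<xi>. ennreal ((cmod (fourier_integral (\<lambda>x. indicator {-R..R} x * rep_L2 \<phi> x) \<xi>
                                       - rep_L2 \<psi> \<xi>))\<^sup>2) \<partial>lborel) \<longlongrightarrow> 0) at_top)"

definition hermite :: "nat \<Rightarrow> real \<Rightarrow> real" where
  "hermite n x = (-1) ^ n * exp (x\<^sup>2) * (deriv ^^ n) (\<lambda>t. exp (- t\<^sup>2)) x"

definition hermite_fun :: "nat \<Rightarrow> real \<Rightarrow> real" where
  "hermite_fun n x = hermite n x * exp (- x\<^sup>2 / 2) / sqrt (2 ^ n * fact n * sqrt pi)"

definition mittag_leffler_space :: "real \<Rightarrow> (complex \<Rightarrow> complex) set" where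
  "mittag_leffler_space q = {f. f holomorphic_on UNIV \<and>
     (\<exists>a. (\<forall>z. (\<lambda>n. a n * z ^ n) sums f z) \<and>
          summable (\<lambda>n. Gamma (q * real n + 1) * (cmod (a n))\<^sup>2))}"

definition MLB_kernel :: "real \<Rightarrow> complex \<Rightarrow> real \<Rightarrow> complex" where
  "MLB_kernel q z x =
     (\<Sum>n. cnj z ^ n / complex_of_real (sqrt (Gamma (q * real n + 1)))
            * complex_of_real (hermite_fun n x))"

definition MLB :: "real \<Rightarrow> L2 \<Rightarrow> complex \<Rightarrow> complex" where
  "MLB q \<phi> z = (LINT x|lborel. cnj (MLB_kernel q z x) * rep_L2 \<phi> x)"

text \<open>\<open>inv (MLB q)\<close> is used only on the range of the injective map \<open>MLB q\<close>, which is
  \<open>mittag_leffler_space q\<close>; outside \<open>mittag_leffler_space q\<close> the value of \<open>MLB_fourier q\<close> has no meaning.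

  On the sign: \<open>fourier_L2\<close> multiplies the \<open>n\<close>-th Hermite function by \<open>(- \<i>) ^ n\<close>, and \<open>MLB q\<close>
  sends it to a multiple of \<open>z ^ n\<close>, so this operator sends \<open>f\<close> to \<open>\<lambda>z. f (- \<i> * z)\<close>. The source
  prints \<open>- f (- \<i> * z)\<close>, which already fails for \<open>f = 1\<close>, the image of the Gaussian.\<close>

definition MLB_fourier :: "real \<Rightarrow> (complex \<Rightarrow> complex) \<Rightarrow> complex \<Rightarrow> complex" where
  "MLB_fourier q = MLB q \<circ> fourier_L2 \<circ> inv (MLB q)"

end

theory Submission
  imports Defs "HOL-Probability.Levy" "HOL-Real_Asymp.Real_Asymp"
begin

text \<open>\<open>MLB q\<close> sends a function with Hermite coefficients \<open>c n\<close> to the power series with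
  coefficients \<open>c n / sqrt (Gamma (q * n + 1))\<close>, so its bijectivity says that \<open>L\<^sup>2\<close> is isomorphic to
  \<open>\<ell>\<^sup>2\<close> through Hermite coefficients (completeness and Riesz-Fischer). The Fourier transform
  multiplies \<open>c n\<close> by \<open>(- \<i>) ^ n\<close>, which for power series is the substitution of \<open>- \<i> * z\<close> for \<open>z\<close>.

  Completeness follows from the uniqueness of characteristic functions: if \<open>h\<close> is orthogonal to all
  Hermite functions, then \<open>h\<close> times the Gaussian has vanishing moments, hence a vanishing Fourier
  transform. Here \<open>h\<close> need not lie in \<open>L\<^sup>2\<close>: the same argument identifies the Fourier integral of a
  function in \<open>L\<^sup>1\<close> and \<open>L\<^sup>2\<close>, a priori only bounded, with its Hermite expansion.\<close>

subsection \<open>Hermite functions and their Fourier integrals\<close>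

text \<open>Plancherel's theorem emerges here from the Hermite coefficients. The multiplication
  formula moves a Fourier integral onto the Hermite function, which is an eigenfunction, so for an
  integrable argument the coefficients are simply multiplied by (- i)^n. These factors have modulus
  1: Riesz-Fischer supplies an L^2 function with the new coefficients, and Parseval makes the
  passage isometric. This evaluates the definite description in \<open>fourier_L2\<close>. For the
  candidate so constructed, the distance from the Fourier integral of the truncation to [-R, R]
  equals the distance from that truncation to the function itself, which tends to 0. On the Bargmann
  side the obstacle is the exchange of sum and integral in the kernel. It rests on the Hermite
  functions having norm 1 and on Gamma (q n + 1) outgrowing every geometric sequence.\<close>

fun hermite_poly :: "nat \<Rightarrow> real poly" where
  "hermite_poly 0 = 1"
| "hermite_poly (Suc n) = [:0, 2:] * hermite_poly n - pderiv (hermite_poly n)"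

text \<open>The Appell property. It turns the differential recurrence into a three-term recurrence
  and lowers the second index in the orthogonality relation.\<close>

lemma pderiv_hermite_poly_Suc:
  "pderiv (hermite_poly (Suc n)) = smult (2 * real (Suc n)) (hermite_poly n)"
proof (induction n)
  case 0
  show ?case by (simp add: pderiv_pCons)
next
  case (Suc n)
  have "pderiv (hermite_poly (Suc (Suc n))) =
      smult 2 (hermite_poly (Suc n)) + [:0, 2:] * pderiv (hermite_poly (Suc n))
      - pderiv (pderiv (hermite_poly (Suc n)))"
    by (subst hermite_poly.simps(2)) (simp add: pderiv_diff pderiv_mult pderiv_pCons pderiv_smult
        del: hermite_poly.simps)
  also have "\<dots> = smult 2 (hermite_poly (Suc n)) + smult (2 * real (Suc n)) (hermite_poly (Suc n))"
    unfolding Suc.IH pderiv_smult by (simp add: algebra_simps smult_diff_right)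
  also have "\<dots> = smult (2 * real (Suc (Suc n))) (hermite_poly (Suc n))"
    by (simp add: algebra_simps flip: smult_add_left)
  finally show ?case .
qed

text \<open>For \<open>n = 0\<close> the truncated index \<open>n - 1\<close> is 0, which is
  harmless because of the factor \<open>real n\<close>.\<close>

lemma hermite_poly_rec:
  "hermite_poly (Suc n) = [:0, 2:] * hermite_poly n - smult (2 * real n) (hermite_poly (n - 1))"
  by (cases n) (simp_all add: pderiv_hermite_poly_Suc hermite_poly.simps(2)[of "Suc _"]
      hermite_poly.simps(2)[of 0] pderiv_1 one_pCons del: hermite_poly.simps(2))

text \<open>The origin of the recurrence in \<open>hermite_poly\<close>: differentiation turns p exp
  (- t^2) into (p' - 2 t p) exp (- t^2), and the sign goes into the power of -1.\<close>

lemma higher_deriv_gauss: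
  "(deriv ^^ n) (\<lambda>t::real. exp (- t\<^sup>2)) = (\<lambda>t. (-1) ^ n * poly (hermite_poly n) t * exp (- t\<^sup>2))"
proof (induction n)
  case (Suc n)
  have *: "deriv (\<lambda>t. (-1) ^ n * poly (hermite_poly n) t * exp (- t\<^sup>2)) x
      = (-1) ^ Suc n * poly (hermite_poly (Suc n)) x * exp (- x\<^sup>2)" for x
    by (rule DERIV_imp_deriv) (auto intro!: derivative_eq_intros simp: algebra_simps)
  show ?case
    by (simp only: funpow.simps comp_apply Suc.IH) (rule ext, rule *)
qed simp

lemma hermite_eq_poly: "hermite n x = poly (hermite_poly n) x"
proof -
  have "(-1) ^ n * exp (x\<^sup>2) * ((-1) ^ n * poly (hermite_poly n) x * exp (- x\<^sup>2))
     = ((-1) ^ n * (-1) ^ n) * (exp (x\<^sup>2) * exp (- x\<^sup>2)) * poly (hermite_poly n) x"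
       by (simp only: ac_simps)
  also have "\<dots> = poly (hermite_poly n) x"
    by (simp flip: exp_add power_mult_distrib)
  finally show ?thesis by (simp add: hermite_def higher_deriv_gauss)
qed

definition hermite_norm :: "nat \<Rightarrow> real" where
  "hermite_norm n = sqrt (2 ^ n * fact n * sqrt pi)"

lemma hermite_norm_pos: "hermite_norm n > 0"
  by (simp add: hermite_norm_def)

lemma hermite_fun_eq: "hermite_fun n x = poly (hermite_poly n) x * exp (- x\<^sup>2 / 2) / hermite_norm n"
  by (simp add: hermite_fun_def hermite_eq_poly hermite_norm_def)

section \<open>Gaussian integrals and orthonormality\<close>

lemma integrable_poly_gauss: "integrable lborel (\<lambda>x::real. poly p x * exp (- x\<^sup>2 / 2))"
proof -
  have "integrable lborel (\<lambda>x::real. x ^ k * exp (- x\<^sup>2 / 2))" for k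
  proof -
    have "integrable lborel (\<lambda>x. sqrt (2 * pi) * (std_normal_density x * x ^ k))"
      by (intro integrable_mult_right integrable_std_normal_moment)
    then show ?thesis by (simp add: std_normal_density_def mult.commute)
  qed
  then have "integrable lborel (\<lambda>x::real. \<Sum>i\<le>degree p. coeff p i * (x ^ i * exp (- x\<^sup>2 / 2)))"
    by (intro Bochner_Integration.integrable_sum integrable_mult_right)
  then show ?thesis by (simp add: poly_altdef sum_distrib_right mult.assoc)
qed

lemma integrable_poly_gauss2: "integrable lborel (\<lambda>x::real. poly p x * exp (- x\<^sup>2))"
proof (rule Bochner_Integration.integrable_bound[OF integrable_poly_gauss[of p]])
  show "AE x in lborel. norm (poly p x * exp (- x\<^sup>2)) \<le> norm (poly p x * exp (- x\<^sup>2 / 2))"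
    by (auto simp: abs_mult intro!: mult_left_mono)
qed (auto intro!: borel_measurable_continuous_onI continuous_intros)

lemma tendsto_poly_gauss:
  "((\<lambda>x::real. poly p x * exp (- x\<^sup>2 / 2)) \<longlongrightarrow> 0) at_top"
  "((\<lambda>x::real. poly p x * exp (- x\<^sup>2 / 2)) \<longlongrightarrow> 0) at_bot"
proof -
  have top: "((\<lambda>x::real. poly p x * exp (- x\<^sup>2 / 2)) \<longlongrightarrow> 0) at_top" for p
  proof -
    have "((\<lambda>x::real. x ^ k * exp (- x\<^sup>2 / 2)) \<longlongrightarrow> 0) at_top" for k by real_asymp
    then have "((\<lambda>x::real. \<Sum>i\<le>degree p. coeff p i * (x ^ i * exp (- x\<^sup>2 / 2)))
        \<longlongrightarrow> (\<Sum>i\<le>degree p. coeff p i * 0)) at_top"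
      by (intro tendsto_sum tendsto_mult tendsto_const)
    then show ?thesis by (simp add: poly_altdef sum_distrib_right mult.assoc)
  qed
  show "((\<lambda>x::real. poly p x * exp (- x\<^sup>2 / 2)) \<longlongrightarrow> 0) at_top" by (rule top)
  have "((\<lambda>x::real. poly (pcompose p [:0,-1:]) x * exp (- x\<^sup>2 / 2)) \<longlongrightarrow> 0) at_top" by (rule top)
  then show "((\<lambda>x::real. poly p x * exp (- x\<^sup>2 / 2)) \<longlongrightarrow> 0) at_bot"
    by (simp add: filterlim_at_bot_mirror poly_pcompose)
qed

text \<open>Integration by parts on the whole line, where the boundary terms vanish. It is applied
  to real functions for orthogonality and to complex ones for Fourier integrals, hence the general
  codomain.\<close>

lemma integral_derivative_eq_0:
  fixes F f :: "real \<Rightarrow> 'a::euclidean_space"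
  assumes F: "\<And>x. (F has_vector_derivative f x) (at x)"
    and cont: "\<And>x. isCont f x" and int: "integrable lborel f"
    and top: "(F \<longlongrightarrow> 0) at_top" and bot: "(F \<longlongrightarrow> 0) at_bot"
  shows "integral\<^sup>L lborel f = 0"
proof -
  have "(LBINT x=-\<infinity>..\<infinity>. f x) = 0 - 0"
  proof (rule interval_integral_FTC_integrable[where F=F])
    show "set_integrable lborel (einterval (-\<infinity>) \<infinity>) f" using int by (simp add: set_integrable_def)
    show "((F \<circ> real_of_ereal) \<longlongrightarrow> 0) (at_right (-\<infinity>))" using bot by (simp add: ereal_tendsto_simps)
    show "((F \<circ> real_of_ereal) \<longlongrightarrow> 0) (at_left \<infinity>)" using top by (simp add: ereal_tendsto_simps)
  qed (auto intro: F cont)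
  then show ?thesis
    by (simp add: interval_lebesgue_integral_def set_lebesgue_integral_def)
qed

lemma integral_gauss2: "(\<integral>x. exp (- x\<^sup>2) \<partial>lborel) = sqrt pi"
proof -
  have *: "normal_density 0 (1 / sqrt 2) = (\<lambda>x. exp (- x\<^sup>2) / sqrt pi)"
    by (simp add: normal_density_def fun_eq_iff power_divide)
  have "(\<integral>x. normal_density 0 (1 / sqrt 2) x \<partial>lborel) = 1"
    by (rule integral_normal_density) simp
  then show ?thesis unfolding * by simp
qed

text \<open>The raising operator 2 x - d/dx is the adjoint of d/dx for the weight exp (- x^2). So
  lowering the first index differentiates the other factor (\<open>rec\<close>), and by the Appell
  property this lowers the second index too. The factors 2 (k + 1) collected on the way multiply up
  to 2^n n!.\<close>

lemma integral_hermite_poly_mult: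
  "(\<integral>x. poly (hermite_poly n * hermite_poly m) x * exp (- x\<^sup>2) \<partial>lborel)
    = (if n = m then 2 ^ n * fact n * sqrt pi else 0)"
proof -
  define J where "J = (\<lambda>p::real poly. \<integral>x. poly p x * exp (- x\<^sup>2) \<partial>lborel)"
  have J_diff: "J (p - q) = J p - J q" for p q
    unfolding J_def by (simp add: left_diff_distrib integrable_poly_gauss2)
  have J_smult: "J (smult c p) = c * J p" for c p
    unfolding J_def by (simp add: mult.assoc)
  have J_deriv: "J (pderiv p - [:0,2:] * p) = 0" for p
    unfolding J_def
  proof (rule integral_derivative_eq_0[where F="\<lambda>x. poly p x * exp (- x\<^sup>2)"])
    show "((\<lambda>x. poly p x * exp (- x\<^sup>2)) has_vector_derivative
        poly (pderiv p - [:0, 2:] * p) x * exp (- x\<^sup>2)) (at x)" for x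
      by (auto intro!: derivative_eq_intros simp flip: has_real_derivative_iff_has_vector_derivative
          simp: algebra_simps)
    have *: "norm (poly p x * exp (- x\<^sup>2)) \<le> norm (poly p x * exp (- x\<^sup>2 / 2))" for x
      by (auto simp: abs_mult intro!: mult_left_mono)
    show "((\<lambda>x. poly p x * exp (- x\<^sup>2)) \<longlongrightarrow> 0) at_top"
      by (rule Lim_null_comparison[OF always_eventually[OF allI[OF *]] tendsto_norm_zero[OF
          tendsto_poly_gauss(1)]])
    show "((\<lambda>x. poly p x * exp (- x\<^sup>2)) \<longlongrightarrow> 0) at_bot"
      by (rule Lim_null_comparison[OF always_eventually[OF allI[OF *]] tendsto_norm_zero[OF
          tendsto_poly_gauss(2)]])
  qed (intro integrable_poly_gauss2 continuous_intros)+
  have rec: "J (hermite_poly (Suc n) * p) = J (hermite_poly n * pderiv p)" for n p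
  proof -
    have *: "hermite_poly (Suc n) * p = hermite_poly n * pderiv p - (pderiv (hermite_poly n * p)
        - [:0,2:] * (hermite_poly n * p))"
      by (simp add: pderiv_mult algebra_simps)
    show ?thesis unfolding * by (subst J_diff) (simp only: J_deriv diff_zero)
  qed
  have "J (hermite_poly n * hermite_poly m) = (if n = m then 2 ^ n * fact n * sqrt pi else 0)"
  proof (induction n arbitrary: m)
    case 0
    show ?case
    proof (cases m)
      case 0 then show ?thesis by (simp add: J_def integral_gauss2)
    next
      case (Suc k)
      have "J (hermite_poly m) = J (hermite_poly (Suc k) * 1)" using Suc by simp
      also have "\<dots> = 0" unfolding rec by (simp add: J_def)
      finally show ?thesis using Suc by simp
    qed
  next
    case (Suc n)
    show ?case
    proof (cases m)
      case 0
      have "J (hermite_poly (Suc n) * 1) = 0" unfolding rec by (simp add: J_def)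
      then show ?thesis using 0 by simp
    next
      case (Suc k)
      have "J (hermite_poly (Suc n) * hermite_poly m)
          = 2 * real (Suc k) * J (hermite_poly n * hermite_poly k)"
        unfolding rec Suc pderiv_hermite_poly_Suc mult_smult_right J_smult ..
      then show ?thesis unfolding Suc.IH Suc by simp
    qed
  qed
  then show ?thesis by (simp add: J_def)
qed

lemma hermite_fun_mult:
  "hermite_fun n x * hermite_fun m x
     = poly (hermite_poly n * hermite_poly m) x * exp (- x\<^sup>2) / (hermite_norm n * hermite_norm m)"
proof -
  have "exp (- x\<^sup>2 / 2) * exp (- x\<^sup>2 / 2) = exp (- x\<^sup>2)" by (simp flip: exp_add)
  then have "poly (hermite_poly n) x * poly (hermite_poly m) x * (exp (- x\<^sup>2 / 2) * exp (- x\<^sup>2 / 2))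
    = poly (hermite_poly n * hermite_poly m) x * exp (- x\<^sup>2)" by simp
  then show ?thesis unfolding hermite_fun_eq by (simp add: ac_simps)
qed

lemma integrable_hermite_fun_mult: "integrable lborel (\<lambda>x. hermite_fun n x * hermite_fun m x)"
  unfolding hermite_fun_mult by (intro integrable_divide integrable_poly_gauss2)

lemma hermite_fun_orthonormal:
  "(\<integral>x. hermite_fun n x * hermite_fun m x \<partial>lborel) = (if n = m then 1 else 0)"
proof -
  have "hermite_norm n * hermite_norm n = 2 ^ n * fact n * sqrt pi" by (simp add: hermite_norm_def)
  then show ?thesis
    unfolding hermite_fun_mult integral_divide_zero integral_hermite_poly_mult
      using hermite_norm_pos[of n] by auto
qed

lemma continuous_hermite_fun: "continuous_on A (hermite_fun n)"
  unfolding hermite_fun_eq[abs_def] using hermite_norm_pos[of n]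
  by (intro continuous_intros) auto

lemma borel_measurable_hermite_fun [measurable]: "hermite_fun n \<in> borel_measurable borel"
  by (intro borel_measurable_continuous_onI continuous_hermite_fun)

lemma integrable_hermite_fun: "integrable lborel (hermite_fun n)"
  unfolding hermite_fun_eq[abs_def] by (intro integrable_divide integrable_poly_gauss)

section \<open>Fourier integrals of polynomials times the Gaussian\<close>

lemma fourier_integral_gauss:
  "fourier_integral (\<lambda>x. of_real (exp (- x\<^sup>2 / 2))) \<xi> = of_real (exp (- \<xi>\<^sup>2 / 2))"
proof -
  \<comment> \<open>The characteristic function has the kernel exp (i t x), the Fourier integral exp
    (- i \<xi> x), hence the argument \<open>-\<xi>\<close>.\<close>
  have "char std_normal_distribution (-\<xi>) = complex_of_real (exp (- \<xi>\<^sup>2 / 2))"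
    by (simp add: char_std_normal_distribution)
  also have "char std_normal_distribution (-\<xi>)
      = (LINT x|lborel. std_normal_density x *\<^sub>R iexp (-\<xi> * x))"
    unfolding char_def by (subst integral_density) (auto simp: normal_density_nonneg)
  also have "\<dots> = (LINT x|lborel. (1 / sqrt (2 * pi)) *\<^sub>R (exp (- \<i> * of_real (\<xi> * x)) * of_real (exp
      (- x\<^sup>2 / 2))))"
    by (intro Bochner_Integration.integral_cong) (auto simp: std_normal_density_def
        scaleR_conv_of_real)
  also have "\<dots> = fourier_integral (\<lambda>x. of_real (exp (- x\<^sup>2 / 2))) \<xi>"
    unfolding fourier_integral_def integral_scaleR_right by (simp add: scaleR_conv_of_real)
  finally show ?thesis .
qed

lemma integrable_fourier_kernel:
  fixes f :: "real \<Rightarrow> complex"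
  assumes "integrable lborel f"
  shows "integrable lborel (\<lambda>x. exp (- \<i> * of_real (\<xi> * x)) * f x)"
proof (rule Bochner_Integration.integrable_bound[OF assms])
  show "(\<lambda>x. exp (- \<i> * of_real (\<xi> * x)) * f x) \<in> borel_measurable lborel"
    using borel_measurable_integrable[OF assms] by measurable
qed (simp add: norm_mult)

lemma fourier_integral_linear:
  assumes "integrable lborel f" "integrable lborel g"
  shows "fourier_integral (\<lambda>x. a * f x + b * g x) \<xi>
      = a * fourier_integral f \<xi> + b * fourier_integral g \<xi>"
proof -
  have "(LINT x|lborel. exp (- \<i> * of_real (\<xi> * x)) * (a * f x + b * g x))
      = (LINT x|lborel. a * (exp (- \<i> * of_real (\<xi> * x)) * f x)
          + b * (exp (- \<i> * of_real (\<xi> * x)) * g x))"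
    by (intro Bochner_Integration.integral_cong) (auto simp: algebra_simps)
  also have "\<dots> = a * (LINT x|lborel. exp (- \<i> * of_real (\<xi> * x)) * f x)
      + b * (LINT x|lborel. exp (- \<i> * of_real (\<xi> * x)) * g x)"
    using assms[THEN integrable_fourier_kernel, of \<xi>] by simp
  finally show ?thesis by (simp add: fourier_integral_def algebra_simps)
qed

definition poly_gauss :: "real poly \<Rightarrow> real \<Rightarrow> complex" where
  "poly_gauss p x = of_real (poly p x * exp (- x\<^sup>2 / 2))"

lemma integrable_poly_gauss_complex: "integrable lborel (poly_gauss p)"
  unfolding poly_gauss_def[abs_def] by (intro integrable_of_real integrable_poly_gauss)

text \<open>The left side transforms the derivative of \<open>poly_gauss p\<close>; integration by
  parts moves the derivative to the kernel.\<close>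

lemma fourier_integral_poly_gauss_deriv:
  "fourier_integral (poly_gauss (pderiv p - [:0,1:] * p)) \<xi>
      = \<i> * of_real \<xi> * fourier_integral (poly_gauss p) \<xi>"
proof -
  \<comment> \<open>The derivative of the kernel times \<open>poly_gauss p\<close>. The coefficient
    1 is written out so that the bracket has the shape of
    \<open>fourier_integral_linear\<close>.\<close>
  let ?D = "\<lambda>x. exp (- \<i> * of_real (\<xi> * x)) * (1 * poly_gauss (pderiv p - [:0,1:] * p) x
      + (- \<i> * of_real \<xi>) * poly_gauss p x)"
  have "integral\<^sup>L lborel ?D = 0"
  proof (rule integral_derivative_eq_0[where F="\<lambda>x. exp (- \<i> * of_real (\<xi> * x)) * poly_gauss p x"])
    fix x
    have 1: "((\<lambda>x. exp (- \<i> * of_real (\<xi> * x))) has_vector_derivative (- \<i> * of_real \<xi>) * exp (- \<i> *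
        of_real (\<xi> * x))) (at x)"
    proof -
      have "((\<lambda>z. exp (- \<i> * (of_real \<xi> * z))) has_field_derivative (- \<i> * of_real \<xi>) * exp (- \<i> *
          of_real (\<xi> * x))) (at (of_real x))"
        by (auto intro!: derivative_eq_intros)
      from has_vector_derivative_real_field[OF this] show ?thesis by simp
    qed
    have 2: "(poly_gauss p has_vector_derivative poly_gauss (pderiv p - [:0,1:] * p) x) (at x)"
      unfolding poly_gauss_def[abs_def]
      by (intro has_vector_derivative_of_real) (auto intro!: derivative_eq_intros simp flip:
          has_real_derivative_iff_has_vector_derivative simp: algebra_simps)
    show "((\<lambda>x. exp (- \<i> * of_real (\<xi> * x)) * poly_gauss p x) has_vector_derivative ?D x) (at x)"
      by (rule has_vector_derivative_eq_rhs[OF has_vector_derivative_mult[OF 1 2]]) (simp add: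
          algebra_simps)
    show "isCont ?D x"
      unfolding poly_gauss_def by (intro continuous_intros) auto
  next
    show "integrable lborel ?D"
      by (intro integrable_fourier_kernel Bochner_Integration.integrable_add integrable_mult_right
          integrable_poly_gauss_complex)
    have *: "norm (exp (- \<i> * of_real (\<xi> * x)) * poly_gauss p x) \<le> norm (poly p x * exp (- x\<^sup>2 / 2))"
        for x
      by (simp add: norm_mult poly_gauss_def)
    show "((\<lambda>x. exp (- \<i> * of_real (\<xi> * x)) * poly_gauss p x) \<longlongrightarrow> 0) at_top"
      by (rule Lim_null_comparison[OF always_eventually[OF allI[OF *]] tendsto_norm_zero[OF
          tendsto_poly_gauss(1)]])
    show "((\<lambda>x. exp (- \<i> * of_real (\<xi> * x)) * poly_gauss p x) \<longlongrightarrow> 0) at_bot"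
      by (rule Lim_null_comparison[OF always_eventually[OF allI[OF *]] tendsto_norm_zero[OF
          tendsto_poly_gauss(2)]])
  qed
  then have "fourier_integral (\<lambda>x. 1 * poly_gauss (pderiv p - [:0,1:] * p) x
      + (- \<i> * of_real \<xi>) * poly_gauss p x) \<xi> = 0"
    by (simp add: fourier_integral_def)
  then have "1 * fourier_integral (poly_gauss (pderiv p - [:0,1:] * p)) \<xi>
      + (- \<i> * of_real \<xi>) * fourier_integral (poly_gauss p) \<xi> = 0"
    by (simp only: fourier_integral_linear[OF integrable_poly_gauss_complex
        integrable_poly_gauss_complex])
  then show ?thesis by simp
qed

text \<open>With \<open>u n\<close> the Hermite polynomial times the Gaussian, \<open>u (n + 1) = 2 n u (n - 1) - 2 (u n)'\<close>,
  so the Fourier integrals of the \<open>u n\<close> obey a recurrence that needs no differentiation under the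
  integral.\<close>

lemma fourier_integral_hermite_poly_gauss:
  "fourier_integral (poly_gauss (hermite_poly n)) \<xi> = (- \<i>) ^ n * poly_gauss (hermite_poly n) \<xi>"
proof (induction n rule: less_induct)
  case (less n)
  show ?case
  proof (cases n)
    case 0
    then show ?thesis using fourier_integral_gauss[of \<xi>] by (simp add: poly_gauss_def[abs_def])
  next
    case (Suc m)
    let ?P = "pderiv (hermite_poly m) - [:0,1:] * hermite_poly m"
    have pd: "pderiv (hermite_poly m) = smult (2 * real m) (hermite_poly (m - 1))"
      by (cases m) (simp_all add: pderiv_hermite_poly_Suc del: hermite_poly.simps(2) add: pderiv_1)
    have "poly (hermite_poly (Suc m)) x = 2 * real m * poly (hermite_poly (m - 1)) x
        - 2 * poly ?P x" for x
      using arg_cong[OF pd, of "\<lambda>p. poly p x"] by (simp add: algebra_simps)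
    note * = this
    have "poly_gauss (hermite_poly n) = (\<lambda>x. of_real (2 * real m) * poly_gauss (hermite_poly (m - 1)) x
        + (-2) * poly_gauss ?P x)"
      unfolding Suc by (rule ext, simp only: poly_gauss_def *, simp add: algebra_simps)
    then have "fourier_integral (poly_gauss (hermite_poly n)) \<xi> =
        of_real (2 * real m) * fourier_integral (poly_gauss (hermite_poly (m - 1))) \<xi>
            + (-2) * fourier_integral (poly_gauss ?P) \<xi>"
      by (simp only: fourier_integral_linear[OF integrable_poly_gauss_complex
          integrable_poly_gauss_complex])
    also have "\<dots> = of_real (2 * real m) * ((- \<i>) ^ (m - 1) * poly_gauss (hermite_poly (m - 1)) \<xi>)
        - 2 * (\<i> * of_real \<xi> * ((- \<i>) ^ m * poly_gauss (hermite_poly m) \<xi>))"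
      unfolding fourier_integral_poly_gauss_deriv using less.IH[of m] less.IH[of "m - 1"] Suc
        by simp
    also have "\<dots> = (- \<i>) ^ n * (2 * of_real \<xi> * poly_gauss (hermite_poly m) \<xi>
        - of_real (2 * real m) * poly_gauss (hermite_poly (m - 1)) \<xi>)"
      unfolding Suc by (cases m) (simp_all add: algebra_simps)
    also have "2 * of_real \<xi> * poly_gauss (hermite_poly m) \<xi>
        - of_real (2 * real m) * poly_gauss (hermite_poly (m - 1)) \<xi>
        = poly_gauss (hermite_poly n) \<xi>"
      unfolding Suc hermite_poly_rec by (simp add: poly_gauss_def algebra_simps)
    finally show ?thesis .
  qed
qed

lemma fourier_integral_hermite_fun:
  "fourier_integral (\<lambda>x. of_real (hermite_fun n x)) \<xi> = (- \<i>) ^ n * of_real (hermite_fun n \<xi>)"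
proof -
  \<comment> \<open>The vanishing second summand only provides the two-term shape of
    \<open>fourier_integral_linear\<close>.\<close>
  have *: "(\<lambda>x. complex_of_real (hermite_fun n x))
      = (\<lambda>x. (1 / of_real (hermite_norm n)) * poly_gauss (hermite_poly n) x + 0 * poly_gauss 0 x)"
    by (simp add: hermite_fun_eq poly_gauss_def)
  show ?thesis
    unfolding * by (subst fourier_integral_linear) (auto intro: integrable_poly_gauss_complex simp:
        fourier_integral_hermite_poly_gauss fun_cong[OF *])
qed

subsection \<open>Hermite expansions in mean square\<close>

lemma square_integrable_measurable [measurable_dest]:
  "square_integrable f \<Longrightarrow> f \<in> borel_measurable borel"
  by (simp add: square_integrable_def)

lemma square_integrable_mult_integrable:
  assumes "square_integrable f" "square_integrable g"
  shows "integrable lborel (\<lambda>x. f x * g x)"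
proof (rule Bochner_Integration.integrable_bound)
  show "integrable lborel (\<lambda>x. (cmod (f x))\<^sup>2 + (cmod (g x))\<^sup>2)"
    using assms by (simp add: square_integrable_def)
  show "(\<lambda>x. f x * g x) \<in> borel_measurable lborel"
    using assms by (auto simp: square_integrable_def)
  have "2 * (cmod (f x) * cmod (g x)) \<le> (cmod (f x))\<^sup>2 + (cmod (g x))\<^sup>2" for x
    using sum_squares_bound[of "cmod (f x)" "cmod (g x)"] by simp
  then have "cmod (f x) * cmod (g x) \<le> (cmod (f x))\<^sup>2 + (cmod (g x))\<^sup>2" for x
    by (smt (verit, best) mult_nonneg_nonneg norm_ge_zero)
  then show "AE x in lborel. norm (f x * g x) \<le> norm ((cmod (f x))\<^sup>2 + (cmod (g x))\<^sup>2)"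
    by (auto simp: norm_mult)
qed

lemma square_integrable_cmult: "square_integrable f \<Longrightarrow> square_integrable (\<lambda>x. c * f x)"
  by (auto simp: square_integrable_def norm_mult power_mult_distrib)

lemma square_integrable_add:
  assumes "square_integrable f" "square_integrable g"
  shows "square_integrable (\<lambda>x. f x + g x)"
  unfolding square_integrable_def
proof
  show "(\<lambda>x. f x + g x) \<in> borel_measurable lborel"
    using assms by (auto simp: square_integrable_def)
  show "integrable lborel (\<lambda>x. (cmod (f x + g x))\<^sup>2)"
  proof (rule Bochner_Integration.integrable_bound)
    show "integrable lborel (\<lambda>x. 2 * (cmod (f x))\<^sup>2 + 2 * (cmod (g x))\<^sup>2)"
      using assms by (simp add: square_integrable_def)
    show "(\<lambda>x. (cmod (f x + g x))\<^sup>2) \<in> borel_measurable lborel"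
      using assms by (auto simp: square_integrable_def)
    have "(cmod (f x + g x))\<^sup>2 \<le> 2 * (cmod (f x))\<^sup>2 + 2 * (cmod (g x))\<^sup>2" for x
    proof -
      have "(cmod (f x + g x))\<^sup>2 \<le> (cmod (f x) + cmod (g x))\<^sup>2"
        by (intro power_mono norm_triangle_ineq) auto
      also have "\<dots> \<le> 2 * (cmod (f x))\<^sup>2 + 2 * (cmod (g x))\<^sup>2"
        using sum_squares_bound[of "cmod (f x)" "cmod (g x)"] by (simp add: power2_sum)
      finally show ?thesis .
    qed
    then show "AE x in lborel. norm ((cmod (f x + g x))\<^sup>2)
        \<le> norm (2 * (cmod (f x))\<^sup>2 + 2 * (cmod (g x))\<^sup>2)"
      by auto
  qed
qed

lemma square_integrable_diff:
  assumes "square_integrable f" "square_integrable g"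
  shows "square_integrable (\<lambda>x. f x - g x)"
  using square_integrable_add[OF assms(1) square_integrable_cmult[OF assms(2), of "-1"]] by simp

lemma square_integrable_hermite_fun: "square_integrable (\<lambda>x. of_real (hermite_fun n x))"
  using integrable_hermite_fun_mult[of n n] by (simp add: square_integrable_def power2_eq_square)

lemma square_integrable_zero: "square_integrable (\<lambda>x. 0)"
  by (simp add: square_integrable_def)

text \<open>The Hermite functions are real, so no conjugate appears. The coefficient is also taken
  of functions that are merely \<open>gauss_tempered\<close>.\<close>

definition hermite_coeff :: "(real \<Rightarrow> complex) \<Rightarrow> nat \<Rightarrow> complex" where
  "hermite_coeff f n = (\<integral>x. of_real (hermite_fun n x) * f x \<partial>lborel)"

text \<open>The index set is arbitrary so that a difference of partial sums is again of this form.
  For infinite \<open>A\<close> the value is 0.\<close>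

definition hermite_sum :: "(nat \<Rightarrow> complex) \<Rightarrow> nat set \<Rightarrow> real \<Rightarrow> complex" where
  "hermite_sum c A x = (\<Sum>n\<in>A. c n * of_real (hermite_fun n x))"

lemma square_integrable_hermite_sum: "square_integrable (hermite_sum c A)"
proof (induction A rule: infinite_finite_induct)
  case (insert n A)
  then show ?case
    using square_integrable_add[OF square_integrable_cmult[OF square_integrable_hermite_fun, of "c
        n" n] insert.IH]
    by (simp add: hermite_sum_def[abs_def])
qed (simp_all add: hermite_sum_def[abs_def] square_integrable_zero)

lemma borel_measurable_hermite_sum [measurable]: "hermite_sum c A \<in> borel_measurable borel"
  unfolding hermite_sum_def[abs_def] by measurable

lemma hermite_coeff_add:
  "square_integrable f \<Longrightarrow> square_integrable g \<Longrightarrow>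
    hermite_coeff (\<lambda>x. f x + g x) n = hermite_coeff f n + hermite_coeff g n"
  using square_integrable_mult_integrable[OF square_integrable_hermite_fun, of _ n]
  by (simp add: hermite_coeff_def distrib_left)

lemma hermite_coeff_diff:
  "square_integrable f \<Longrightarrow> square_integrable g \<Longrightarrow>
    hermite_coeff (\<lambda>x. f x - g x) n = hermite_coeff f n - hermite_coeff g n"
  using square_integrable_mult_integrable[OF square_integrable_hermite_fun, of _ n]
  by (simp add: hermite_coeff_def right_diff_distrib)

lemma hermite_coeff_cmult: "hermite_coeff (\<lambda>x. c * f x) n = c * hermite_coeff f n"
  by (simp add: hermite_coeff_def mult.left_commute)

lemma hermite_coeff_hermite_fun:
  "hermite_coeff (\<lambda>x. of_real (hermite_fun m x)) n = (if m = n then 1 else 0)"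
  using hermite_fun_orthonormal[of n m] by (simp add: hermite_coeff_def flip: of_real_mult)

lemma hermite_coeff_hermite_sum:
  assumes "finite A"
  shows "hermite_coeff (hermite_sum c A) n = (if n \<in> A then c n else 0)"
  using assms
proof induction
  case (insert m A)
  have *: "hermite_sum c (insert m A) = (\<lambda>x. c m * of_real (hermite_fun m x) + hermite_sum c A x)"
    using insert by (simp add: hermite_sum_def fun_eq_iff)
  show ?case unfolding *
    by (subst hermite_coeff_add) (use insert in \<open>auto intro!: square_integrable_cmult
        square_integrable_hermite_fun
      square_integrable_hermite_sum simp: hermite_coeff_cmult hermite_coeff_hermite_fun\<close>)
qed (simp add: hermite_sum_def[abs_def] hermite_coeff_def)

lemma hermite_coeff_cong_AE:
  assumes "AE x in lborel. f x = g x" "f \<in> borel_measurable borel" "g \<in> borel_measurable borel"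
  shows "hermite_coeff f n = hermite_coeff g n"
  unfolding hermite_coeff_def using assms by (intro integral_cong_AE) auto

lemma L2_distance_hermite_fun:
  assumes "square_integrable g"
  shows "(\<integral>x. (cmod (g x - c * of_real (hermite_fun n x)))\<^sup>2 \<partial>lborel)
    = (\<integral>x. (cmod (g x))\<^sup>2 \<partial>lborel) - 2 * Re (cnj c * hermite_coeff g n) + (cmod c)\<^sup>2"
proof -
  have 1: "integrable lborel (\<lambda>x. of_real (hermite_fun n x) * g x)"
    by (intro square_integrable_mult_integrable square_integrable_hermite_fun assms)
  define R where "R x = Re (cnj c * (of_real (hermite_fun n x) * g x))" for x
  have 2: "integrable lborel R"
    unfolding R_def[abs_def] by (intro integrable_Re integrable_mult_right 1)
  have 3: "integrable lborel (\<lambda>x. (cmod (g x))\<^sup>2)" using assms by (simp add: square_integrable_def)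
  have "(cmod (g x - c * of_real (hermite_fun n x)))\<^sup>2 =
     (cmod (g x))\<^sup>2 - 2 * R x + (cmod c)\<^sup>2 * (hermite_fun n x * hermite_fun n x)" for x
    unfolding cmod_power2 R_def by (simp add: algebra_simps power2_eq_square)
  then have "(\<integral>x. (cmod (g x - c * of_real (hermite_fun n x)))\<^sup>2 \<partial>lborel)
    = (\<integral>x. (cmod (g x))\<^sup>2 \<partial>lborel) - 2 * (\<integral>x. R x \<partial>lborel)
        + (cmod c)\<^sup>2 * (\<integral>x. hermite_fun n x * hermite_fun n x \<partial>lborel)"
    using 2 3 integrable_hermite_fun_mult[of n n] by simp
  also have "(\<integral>x. R x \<partial>lborel) = Re (cnj c * hermite_coeff g n)"
    unfolding hermite_coeff_def R_def using 1
      by (subst integral_Re) (auto intro: integrable_mult_right)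
  finally show ?thesis by (simp add: hermite_fun_orthonormal)
qed

text \<open>Subtracting the terms in \<open>A\<close> does not change the coefficients outside
  \<open>A\<close>, so the Hermite functions can be split off one at a time. With \<open>c\<close>
  the coefficients of \<open>f\<close> this gives Bessel's inequality, with \<open>f = 0\<close> the
  norm of a finite sum.\<close>

lemma L2_distance_hermite_sum:
  assumes "square_integrable f" "finite A"
  shows "(\<integral>x. (cmod (f x - hermite_sum c A x))\<^sup>2 \<partial>lborel)
    = (\<integral>x. (cmod (f x))\<^sup>2 \<partial>lborel) - (\<Sum>n\<in>A. 2 * Re (cnj (c n) * hermite_coeff f n) - (cmod (c n))\<^sup>2)"
  using assms(2)
proof induction
  case (insert n A)
  have eq: "f x - hermite_sum c (insert n A) x
      = (f x - hermite_sum c A x) - c n * of_real (hermite_fun n x)" for x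
    using insert by (simp add: hermite_sum_def)
  have "square_integrable (\<lambda>x. f x - hermite_sum c A x)"
    by (intro square_integrable_diff square_integrable_hermite_sum assms)
  moreover have "hermite_coeff (\<lambda>x. f x - hermite_sum c A x) n = hermite_coeff f n"
    using insert assms by (simp add: hermite_coeff_diff square_integrable_hermite_sum
        hermite_coeff_hermite_sum)
  ultimately show ?case
    using insert by (simp add: eq L2_distance_hermite_fun)
qed (simp add: hermite_sum_def)

lemma L2_norm_hermite_sum:
  assumes "finite A"
  shows "(\<integral>x. (cmod (hermite_sum c A x))\<^sup>2 \<partial>lborel) = (\<Sum>n\<in>A. (cmod (c n))\<^sup>2)"
  using L2_distance_hermite_sum[OF square_integrable_zero assms, of c]
  by (simp add: hermite_coeff_def sum_negf)

lemma L2_distance_hermite_partial_sum: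
  assumes "square_integrable f"
  shows "(\<integral>x. (cmod (f x - hermite_sum (hermite_coeff f) {..<N} x))\<^sup>2 \<partial>lborel)
    = (\<integral>x. (cmod (f x))\<^sup>2 \<partial>lborel) - (\<Sum>n<N. (cmod (hermite_coeff f n))\<^sup>2)"
proof -
  have "2 * Re (cnj z * z) - (cmod z)\<^sup>2 = (cmod z)\<^sup>2" for z
    unfolding cmod_power2 by (simp add: power2_eq_square)
  then show ?thesis by (simp only: L2_distance_hermite_sum[OF assms finite_lessThan])
qed

lemma hermite_coeff_Bessel:
  assumes "square_integrable f"
  shows "(\<Sum>n<N. (cmod (hermite_coeff f n))\<^sup>2) \<le> (\<integral>x. (cmod (f x))\<^sup>2 \<partial>lborel)"
proof -
  have "0 \<le> (\<integral>x. (cmod (f x - hermite_sum (hermite_coeff f) {..<N} x))\<^sup>2 \<partial>lborel)" by simp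
  then show ?thesis using L2_distance_hermite_partial_sum[OF assms, of N] by simp
qed

text \<open>Continuity of the coefficients in mean square: it passes the coefficients of the partial
  sums on to their limit.\<close>

lemma hermite_coeff_le:
  assumes "square_integrable f"
  shows "(cmod (hermite_coeff f n))\<^sup>2 \<le> (\<integral>x. (cmod (f x))\<^sup>2 \<partial>lborel)"
proof -
  have "(cmod (hermite_coeff f n))\<^sup>2 \<le> (\<Sum>n<Suc n. (cmod (hermite_coeff f n))\<^sup>2)"
    by (simp add: sum_nonneg)
  then show ?thesis using hermite_coeff_Bessel[OF assms, of "Suc n"] by linarith
qed

lemma summable_hermite_coeff:
  assumes "square_integrable f"
  shows "summable (\<lambda>n. (cmod (hermite_coeff f n))\<^sup>2)"
  by (rule summableI_nonneg_bounded[OF _ hermite_coeff_Bessel[OF assms]]) simp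

text \<open>The increments \<open>d k\<close> along a subsequence of the partial sums satisfy \<open>\<integral> \<bar>d k\<bar>\<^sup>2 \<le> (1 / 4) ^ k\<close>,
  so the series of \<open>2 ^ k * \<bar>d k\<bar>\<^sup>2\<close> converges almost everywhere and dominates the \<open>d k\<close> by a
  geometric series. Fatou's lemma turns the pointwise limit into a limit in mean square.\<close>

lemma hermite_Riesz_Fischer:
  assumes c: "summable (\<lambda>n. (cmod (c n))\<^sup>2)"
  obtains f where "square_integrable f" "\<And>n. hermite_coeff f n = c n"
    "(\<lambda>N. \<integral>x. (cmod (f x - hermite_sum c {..<N} x))\<^sup>2 \<partial>lborel) \<longlonglongrightarrow> 0"
proof -
  define S where "S N = hermite_sum c {..<N}" for N
  have [measurable]: "S N \<in> borel_measurable borel" for N unfolding S_def by simp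
  have S_diff: "integrable lborel (\<lambda>x. (cmod (S M x - S N x))\<^sup>2) \<and>
      (\<integral>x. (cmod (S M x - S N x))\<^sup>2 \<partial>lborel) = (\<Sum>n\<in>{N..<M}. (cmod (c n))\<^sup>2)" if "N \<le> M" for M N
  proof -
    have "S M x - S N x = hermite_sum c {N..<M} x" for x
      unfolding S_def hermite_sum_def using that
      by (simp add: sum_diff[symmetric] lessThan_minus_lessThan)
    then show ?thesis
      using square_integrable_hermite_sum[of c "{N..<M}"]
        by (simp add: L2_norm_hermite_sum square_integrable_def)
  qed
  define tail where "tail N = (\<Sum>n. (cmod (c (n + N)))\<^sup>2)" for N
  have tail0: "tail \<longlonglongrightarrow> 0" unfolding tail_def using suminf_exist_split2[OF c] by simp
  have tail_nonneg: "tail N \<ge> 0" for N unfolding tail_def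
    by (intro suminf_nonneg summable_ignore_initial_segment c) auto
  have tail: "(\<Sum>n\<in>{N..<M}. (cmod (c n))\<^sup>2) \<le> tail N" if "N \<le> M" for M N
  proof -
    have "(\<Sum>n\<in>{N..<M}. (cmod (c n))\<^sup>2) = (\<Sum>n<M-N. (cmod (c (n + N)))\<^sup>2)"
      using sum.shift_bounds_nat_ivl[of "\<lambda>n. (cmod (c n))\<^sup>2" 0 N "M - N"] that
        by (simp add: atLeast0LessThan)
    also have "\<dots> \<le> tail N"
      unfolding tail_def by (intro sum_le_suminf summable_ignore_initial_segment c) auto
    finally show ?thesis .
  qed
  \<comment> \<open>The rate 1/4 still leaves a summable (1/2)^k once the weights 2^k are
    inserted.\<close>
  have "\<exists>r0. \<forall>k. tail (r0 k) \<le> (1/4) ^ k \<and> r0 k < r0 (Suc k)"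
  proof (rule dependent_nat_choice)
    have "eventually (\<lambda>n. tail n < (1/4) ^ k) sequentially" for k
      by (rule order_tendstoD(2)[OF tail0]) simp
    then have ev: "\<exists>N. \<forall>n\<ge>N. tail n < (1/4) ^ k" for k by (simp add: eventually_sequentially)
    show "\<exists>x. tail x \<le> (1/4) ^ 0" using ev[of 0] by (auto intro: less_imp_le)
    show "\<exists>y. tail y \<le> (1/4) ^ Suc n \<and> x < y" for x n
    proof -
      obtain N where "\<forall>n'\<ge>N. tail n' < (1/4) ^ Suc n" using ev by blast
      then show ?thesis by (intro exI[of _ "max N (Suc x)"]) (auto intro: less_imp_le)
    qed
  qed
  then obtain r where r: "\<And>k. tail (r k) \<le> (1/4) ^ k" and "\<And>k. r k < r (Suc k)" by blast
  then have r_mono: "strict_mono r" by (simp add: strict_mono_Suc_iff)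
  define d where "d k x = S (r (Suc k)) x - S (r k) x" for k x
  have [measurable]: "d k \<in> borel_measurable borel" for k unfolding d_def by simp
  have d_le: "integrable lborel (\<lambda>x. (cmod (d k x))\<^sup>2)" "(\<integral>x. (cmod (d k x))\<^sup>2 \<partial>lborel) \<le> (1/4) ^ k"
      for k
    using S_diff[of "r k" "r (Suc k)"] tail[of "r k" "r (Suc k)"] r[of k] strict_mono_less_eq[OF
        r_mono, of k "Suc k"]
    unfolding d_def by auto
  have "(\<integral>\<^sup>+x. (\<Sum>k. ennreal (2 ^ k * (cmod (d k x))\<^sup>2)) \<partial>lborel)
      = (\<Sum>k. (\<integral>\<^sup>+x. ennreal (2 ^ k * (cmod (d k x))\<^sup>2) \<partial>lborel))"
    by (intro nn_integral_suminf) simp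
  also have "\<dots> \<le> (\<Sum>k. ennreal ((1/2) ^ k))"
  proof (intro suminf_le)
    fix k
    have "(\<integral>\<^sup>+x. ennreal (2 ^ k * (cmod (d k x))\<^sup>2) \<partial>lborel)
        = ennreal (\<integral>x. 2 ^ k * (cmod (d k x))\<^sup>2 \<partial>lborel)"
      by (intro nn_integral_eq_integral integrable_mult_right d_le) simp
    also have "\<dots> \<le> ennreal ((1/2) ^ k)"
    proof (rule ennreal_leI)
      have "(\<integral>x. 2 ^ k * (cmod (d k x))\<^sup>2 \<partial>lborel) \<le> 2 ^ k * (1/4) ^ k" using d_le(2)[of k] by simp
      also have "(2 ^ k * (1/4) ^ k :: real) = (1/2) ^ k" by (simp flip: power_mult_distrib)
      finally show "(\<integral>x. 2 ^ k * (cmod (d k x))\<^sup>2 \<partial>lborel) \<le> (1/2) ^ k" .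
    qed
    finally show "(\<integral>\<^sup>+x. ennreal (2 ^ k * (cmod (d k x))\<^sup>2) \<partial>lborel) \<le> ennreal ((1/2) ^ k)" .
  qed auto
  also have "\<dots> < \<infinity>"
    by (subst suminf_ennreal2) (auto intro: summable_geometric)
  finally have "AE x in lborel. (\<Sum>k. ennreal (2 ^ k * (cmod (d k x))\<^sup>2)) \<noteq> \<infinity>"
    by (intro nn_integral_PInf_AE) auto
  then have conv: "AE x in lborel. convergent (\<lambda>k. S (r k) x)"
  proof eventually_elim
    case (elim x)
    then have "summable (\<lambda>k. 2 ^ k * (cmod (d k x))\<^sup>2)" by (intro summable_suminf_not_top) auto
    then have "(\<lambda>k. 2 ^ k * (cmod (d k x))\<^sup>2) \<longlonglongrightarrow> 0" by (rule summable_LIMSEQ_zero)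
    then have "eventually (\<lambda>k. 2 ^ k * (cmod (d k x))\<^sup>2 < 1) sequentially"
      by (rule order_tendstoD) simp
    then have "eventually (\<lambda>k. norm (d k x) \<le> (sqrt (1/2)) ^ k) sequentially"
    proof eventually_elim
      case (elim k)
      have "(cmod (d k x))\<^sup>2 \<le> (1/2) ^ k" using elim by (simp add: field_simps)
      also have "\<dots> = ((sqrt (1/2))\<^sup>2) ^ k" by (subst real_sqrt_pow2) simp_all
      also have "\<dots> = ((sqrt (1/2)) ^ k)\<^sup>2" by (simp only: power_mult[symmetric] mult.commute)
      finally show ?case by (rule power2_le_imp_le) simp
    qed
    then have "summable (\<lambda>k. d k x)"
      by (rule summable_comparison_test_ev) (auto intro!: summable_geometric)
    then have "(\<lambda>k. \<Sum>i<k. d i x) \<longlonglongrightarrow> (\<Sum>i. d i x)" by (rule summable_LIMSEQ)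
    moreover have "(\<Sum>i<k. d i x) = S (r k) x - S (r 0) x" for k
      unfolding d_def by (rule sum_lessThan_telescope)
    ultimately have "(\<lambda>k. S (r k) x - S (r 0) x + S (r 0) x) \<longlonglongrightarrow> (\<Sum>i. d i x) + S (r 0) x"
      by (intro tendsto_add tendsto_const) simp
    then show ?case by (auto simp: convergent_def)
  qed
  \<comment> \<open>On the null set where the subsequence diverges, \<open>lim\<close> has an
    unspecified value; measurability holds on the whole line all the same.\<close>
  define f where "f x = lim (\<lambda>k. S (r k) x)" for x
  have [measurable]: "f \<in> borel_measurable borel" unfolding f_def[abs_def] by measurable
  have f_bound: "(\<integral>\<^sup>+x. ennreal ((cmod (f x - S N x))\<^sup>2) \<partial>lborel) \<le> ennreal (tail N)" for N
  proof -
    have "(\<integral>\<^sup>+x. ennreal ((cmod (f x - S N x))\<^sup>2) \<partial>lborel)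
        = (\<integral>\<^sup>+x. liminf (\<lambda>k. ennreal ((cmod (S (r k) x - S N x))\<^sup>2)) \<partial>lborel)"
    proof (rule nn_integral_cong_AE)
      show "AE x in lborel. ennreal ((cmod (f x - S N x))\<^sup>2)
          = liminf (\<lambda>k. ennreal ((cmod (S (r k) x - S N x))\<^sup>2))"
        using conv
      proof eventually_elim
        case (elim x)
        then have "(\<lambda>k. S (r k) x) \<longlonglongrightarrow> f x" unfolding f_def by (simp add: convergent_LIMSEQ_iff)
        then have "(\<lambda>k. ennreal ((cmod (S (r k) x - S N x))\<^sup>2)) \<longlonglongrightarrow> ennreal ((cmod (f x - S N x))\<^sup>2)"
          by (intro tendsto_intros)
        then show ?case by (rule lim_imp_Liminf[OF trivial_limit_sequentially, symmetric])
      qed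
    qed
    also have "\<dots> \<le> liminf (\<lambda>k. \<integral>\<^sup>+x. ennreal ((cmod (S (r k) x - S N x))\<^sup>2) \<partial>lborel)"
      by (rule nn_integral_liminf) simp
    also have "\<dots> \<le> limsup (\<lambda>k. \<integral>\<^sup>+x. ennreal ((cmod (S (r k) x - S N x))\<^sup>2) \<partial>lborel)"
      by (rule Liminf_le_Limsup) simp
    also have "\<dots> \<le> ennreal (tail N)"
    proof (rule Limsup_bounded)
      have "eventually (\<lambda>k. k \<ge> N) sequentially" by (rule eventually_ge_at_top)
      then show "eventually (\<lambda>k. (\<integral>\<^sup>+x. ennreal ((cmod (S (r k) x - S N x))\<^sup>2) \<partial>lborel)
          \<le> ennreal (tail N)) sequentially"
      proof eventually_elim
        case (elim k)
        then have "N \<le> r k" using seq_suble[OF r_mono, of k] by linarith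
        then show ?case using S_diff[of N "r k"] tail[of N "r k"]
          by (subst nn_integral_eq_integral) (auto intro!: ennreal_leI)
      qed
    qed
    finally show ?thesis .
  qed
  have int: "integrable lborel (\<lambda>x. (cmod (f x - S N x))\<^sup>2)" for N
    using f_bound[of N] by (intro integrableI_bounded) (auto intro: order.strict_trans1)
  have int_le: "(\<integral>x. (cmod (f x - S N x))\<^sup>2 \<partial>lborel) \<le> tail N" for N
    using f_bound[of N] nn_integral_eq_integral[OF int[of N]] tail_nonneg[of N] by simp
  \<comment> \<open>\<open>S 0\<close> is the empty sum, so this is the case \<open>N = 0\<close> of
    \<open>int\<close>.\<close>
  have "square_integrable f"
    using int[of 0] by (simp add: square_integrable_def S_def hermite_sum_def)
  moreover have "hermite_coeff f n = c n" for n
  proof -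
    \<comment> \<open>Once \<open>n < N\<close>, the sum \<open>S N\<close> already has
      \<open>c n\<close> as its coefficient, so the error is a coefficient of the remainder and is
      bounded by its mean square.\<close>
    have "(cmod (hermite_coeff f n - c n))\<^sup>2 \<le> tail N" if "n < N" for N
    proof -
      have sq: "square_integrable (\<lambda>x. f x - S N x)"
        using int[of N] by (simp add: square_integrable_def)
      have "hermite_coeff (\<lambda>x. f x - S N x) n = hermite_coeff f n - c n"
        using that \<open>square_integrable f\<close>
        by (simp add: S_def hermite_coeff_diff square_integrable_hermite_sum
            hermite_coeff_hermite_sum)
      then have "(cmod (hermite_coeff f n - c n))\<^sup>2 \<le> (\<integral>x. (cmod (f x - S N x))\<^sup>2 \<partial>lborel)"
        using hermite_coeff_le[OF sq, of n] by simp
      also have "\<dots> \<le> tail N"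
        by (rule int_le)
      finally show ?thesis .
    qed
    then have "(cmod (hermite_coeff f n - c n))\<^sup>2 \<le> 0"
      by (intro tendsto_lowerbound[OF tail0] eventually_mono[OF eventually_gt_at_top[of n]]) auto
    then show ?thesis by simp
  qed
  moreover have "(\<lambda>N. \<integral>x. (cmod (f x - hermite_sum c {..<N} x))\<^sup>2 \<partial>lborel) \<longlonglongrightarrow> 0"
    using int_le by (intro tendsto_sandwich[OF _ _ tendsto_const tail0]) (auto simp: S_def)
  ultimately show ?thesis by (rule that)
qed

subsection \<open>Completeness of the Hermite functions\<close>

text \<open>The positive and negative parts of \<open>u\<close> have the same mass \<open>M\<close>,
  as \<open>t = 0\<close> shows. If \<open>M > 0\<close>, dividing by \<open>M\<close> makes them
  densities of two probability laws with equal characteristic functions; the laws agree, and so do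
  their densities almost everywhere.\<close>

lemma AE_zero_if_char_zero_real:
  fixes u :: "real \<Rightarrow> real"
  assumes u: "integrable lborel u"
    and ft: "\<And>t. (\<integral>x. iexp (t * x) * of_real (u x) \<partial>lborel) = 0"
  shows "AE x in lborel. u x = 0"
proof -
  define p where "p x = max 0 (u x)" for x
  define m where "m x = max 0 (- u x)" for x
  have [measurable]: "u \<in> borel_measurable borel" using u by auto
  have p: "integrable lborel p" and m: "integrable lborel m"
    unfolding p_def[abs_def] m_def[abs_def] using u by auto
  have nn: "p x \<ge> 0" "m x \<ge> 0" for x by (auto simp: p_def m_def)
  have u_eq: "u x = p x - m x" for x by (auto simp: p_def m_def)
  have ker: "integrable lborel (\<lambda>x. iexp (t * x) * of_real (v x))" if "integrable lborel v"
      for v :: "real \<Rightarrow> real" and t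
    using borel_measurable_integrable[OF that]
    by (intro Bochner_Integration.integrable_bound[OF that]) (auto simp: norm_mult)
  have eq: "(\<integral>x. iexp (t * x) * of_real (p x) \<partial>lborel) = (\<integral>x. iexp (t * x) * of_real (m x) \<partial>lborel)"
      for t
    using ft[of t] ker[OF p, of t] ker[OF m, of t] by (simp add: u_eq right_diff_distrib)
  define M where "M = integral\<^sup>L lborel p"
  have "complex_of_real (integral\<^sup>L lborel p) = complex_of_real (integral\<^sup>L lborel m)"
    using eq[of 0] by simp
  then have M': "M = integral\<^sup>L lborel m" by (simp add: M_def)
  have "M \<ge> 0" unfolding M_def by (simp add: nn)
  show ?thesis
  proof (cases "M = 0")
    case True
    then have "AE x in lborel. p x = 0" "AE x in lborel. m x = 0"
      using integral_nonneg_eq_0_iff_AE[OF p] integral_nonneg_eq_0_iff_AE[OF m] nn M_def M' by auto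
    then show ?thesis by eventually_elim (simp add: u_eq)
  next
    case False
    with \<open>M \<ge> 0\<close> have "M > 0" by simp
    define D where "D v = density lborel (\<lambda>x. ennreal (v x / M))" for v :: "real \<Rightarrow> real"
    have D: "real_distribution (D v)"
      "char (D v) t = (\<integral>x. iexp (t * x) * of_real (v x) \<partial>lborel) / M"
      if v: "integrable lborel v" "\<And>x. v x \<ge> 0" "integral\<^sup>L lborel v = M" for v t
    proof -
      have [measurable]: "v \<in> borel_measurable borel" using v by auto
      have "emeasure (D v) (space (D v)) = (\<integral>\<^sup>+x. ennreal (v x / M) \<partial>lborel)"
        unfolding D_def by (simp add: emeasure_density)
      also have "\<dots> = ennreal (\<integral>x. v x / M \<partial>lborel)"
        using v \<open>M > 0\<close> by (intro nn_integral_eq_integral) auto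
      also have "\<dots> = 1" using v \<open>M > 0\<close> by simp
      finally have "prob_space (D v)" by (rule prob_spaceI)
      then show "real_distribution (D v)"
        by (simp add: real_distribution_def real_distribution_axioms_def D_def)
      have "char (D v) t = (\<integral>x. (v x / M) *\<^sub>R iexp (t * x) \<partial>lborel)"
        unfolding char_def D_def using v \<open>M > 0\<close> by (intro integral_density) auto
      also have "\<dots> = (\<integral>x. iexp (t * x) * of_real (v x) / M \<partial>lborel)"
        by (intro Bochner_Integration.integral_cong) (auto simp: scaleR_conv_of_real)
      finally show "char (D v) t = (\<integral>x. iexp (t * x) * of_real (v x) \<partial>lborel) / M" by simp
    qed
    have "D p = D m"
      using D[OF p nn(1) M_def[symmetric]] D[OF m nn(2) M'[symmetric]] eq
      by (intro Levy_uniqueness) (auto simp: fun_eq_iff)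
    then have "AE x in lborel. ennreal (p x / M) = ennreal (m x / M)"
      unfolding D_def using p m by (intro sigma_finite_measure.density_unique[OF
          sigma_finite_lborel]) auto
    then show ?thesis
      using \<open>M > 0\<close> nn by (auto simp: u_eq)
  qed
qed

text \<open>Conjugating the transform of \<open>u\<close> at \<open>- t\<close> gives the transform
  of the conjugate at \<open>t\<close>. Both vanish, and with them the transforms of the real and
  imaginary parts.\<close>

lemma AE_zero_if_char_zero:
  fixes u :: "real \<Rightarrow> complex"
  assumes u: "integrable lborel u"
    and ft: "\<And>t. (\<integral>x. iexp (t * x) * u x \<partial>lborel) = 0"
  shows "AE x in lborel. u x = 0"
proof -
  have ker: "integrable lborel (\<lambda>x. iexp (t * x) * v x)" if "integrable lborel v"
      for v :: "real \<Rightarrow> complex" and t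
    using borel_measurable_integrable[OF that]
    by (intro Bochner_Integration.integrable_bound[OF that]) (auto simp: norm_mult)
  have ft': "(\<integral>x. iexp (t * x) * cnj (u x) \<partial>lborel) = 0" for t
  proof -
    have "(\<integral>x. cnj (iexp ((-t) * x) * u x) \<partial>lborel) = cnj (\<integral>x. iexp ((-t) * x) * u x \<partial>lborel)"
      by (rule Bochner_Integration.integral_cnj)
    also have "\<dots> = 0" unfolding ft by simp
    finally show ?thesis by (simp add: exp_cnj)
  qed
  have "(\<integral>x. iexp (t * x) * of_real (Re (u x)) \<partial>lborel) = 0" for t
  proof -
    have "(\<lambda>x. iexp (t * x) * of_real (Re (u x)))
        = (\<lambda>x. (iexp (t * x) * u x + iexp (t * x) * cnj (u x)) / 2)"
      by (simp add: complex_eq_iff fun_eq_iff field_simps)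
    then show ?thesis using ker[of u t] ker[of "\<lambda>x. cnj (u x)" t] u ft ft' by simp
  qed
  then have re: "AE x in lborel. Re (u x) = 0"
    using u by (intro AE_zero_if_char_zero_real) auto
  have "(\<integral>x. iexp (t * x) * of_real (Im (u x)) \<partial>lborel) = 0" for t
  proof -
    have "(\<lambda>x. iexp (t * x) * of_real (Im (u x)))
        = (\<lambda>x. (iexp (t * x) * u x - iexp (t * x) * cnj (u x)) / (2 * \<i>))"
    proof -
      have "of_real (Im z) = (z - cnj z) / (2 * \<i>)" for z
        by (simp add: complex_diff_cnj complex_eq_iff)
      then show ?thesis by (simp only: right_diff_distrib times_divide_eq_right)
    qed
    then show ?thesis using ker[of u t] ker[of "\<lambda>x. cnj (u x)" t] u ft ft' by simp
  qed
  then have im: "AE x in lborel. Im (u x) = 0"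
    using u by (intro AE_zero_if_char_zero_real) auto
  from re im show ?thesis by eventually_elim (simp add: complex_eq_iff)
qed

text \<open>A single term of the exponential series; it reduces moments of every order to one
  exponential bound.\<close>

lemma abs_power_le_exp: "\<bar>x\<bar> ^ k \<le> fact k * exp \<bar>x::real\<bar>"
proof -
  have "(\<Sum>n\<in>{k}. \<bar>x\<bar> ^ n /\<^sub>R fact n) \<le> (\<Sum>n. \<bar>x\<bar> ^ n /\<^sub>R fact n)"
    by (intro sum_le_suminf summable_exp_generic) auto
  then show ?thesis by (simp add: exp_def field_simps)
qed

text \<open>The bound \<open>bnd\<close> serves twice: with \<open>a = 1\<close> it makes all
  moments of \<open>w\<close> finite, and with \<open>a = \<bar>t\<bar>\<close> it dominates the
  partial sums of the series of exp (i t x), so that the limit may be taken under the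
  integral.\<close>

lemma hermite_complete:
  fixes h :: "real \<Rightarrow> complex"
  assumes [measurable]: "h \<in> borel_measurable borel"
    and bnd: "\<And>a. integrable lborel (\<lambda>x. exp (a * \<bar>x\<bar>) * exp (- x\<^sup>2 / 2) * cmod (h x))"
    and zero: "\<And>n. (\<integral>x. of_real (hermite_fun n x) * h x \<partial>lborel) = 0"
  shows "AE x in lborel. h x = 0"
proof -
  define w where "w x = of_real (exp (- x\<^sup>2 / 2)) * h x" for x
  have [measurable]: "w \<in> borel_measurable borel" unfolding w_def[abs_def] by measurable
  have bnd': "integrable lborel (\<lambda>x. exp (a * \<bar>x\<bar>) * cmod (w x))" for a
    using bnd[of a] by (simp add: w_def norm_mult mult.assoc)
  have mono: "integrable lborel (\<lambda>x. of_real (x ^ k) * w x)" for k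
  proof (rule Bochner_Integration.integrable_bound)
    show "integrable lborel (\<lambda>x. fact k * (exp (1 * \<bar>x\<bar>) * cmod (w x)))"
      by (intro integrable_mult_right bnd')
    have "norm (of_real (x ^ k) * w x) \<le> norm (fact k * (exp (1 * \<bar>x\<bar>) * cmod (w x)))" for x
      using mult_right_mono[OF abs_power_le_exp[of x k] norm_ge_zero[of "w x"]]
      by (simp add: norm_mult norm_power power_abs mult.assoc)
    then show "AE x in lborel. norm (of_real (x ^ k) * w x)
        \<le> norm (fact k * (exp (1 * \<bar>x\<bar>) * cmod (w x)))" by simp
  qed measurable
  have int: "integrable lborel (\<lambda>x. of_real (poly p x) * w x)" for p
  proof -
    have "(\<lambda>x. of_real (poly p x) * w x) = (\<lambda>x. \<Sum>i\<le>degree p. of_real (coeff p i) * (of_real (x ^ i)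
        * w x))"
      by (simp add: poly_altdef sum_distrib_right mult.assoc)
    then show ?thesis
      using mono by (auto intro!: Bochner_Integration.integrable_sum integrable_mult_right simp del:
          of_real_power)
  qed
  define L where "L p = (\<integral>x. of_real (poly p x) * w x \<partial>lborel)" for p
  have L_add: "L (p + q) = L p + L q" for p q
    unfolding L_def using int[of p] int[of q] by (simp add: distrib_right)
  have L_smult: "L (smult c p) = c * L p" for c p
    unfolding L_def by (simp add: mult.assoc)
  \<comment> \<open>Since x H_n = H_(n+1) / 2 + n H_(n-1), each factor x can be traded for a shift
    of the index. The induction on \<open>k\<close> needs \<open>n\<close> arbitrary, and
    \<open>n = 0\<close> then gives the moments.\<close>
  have "L (monom 1 k * hermite_poly n) = 0" for k n
  proof (induction k arbitrary: n)
    case 0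
    have "(\<lambda>x. of_real (hermite_fun n x) * h x)
        = (\<lambda>x. (of_real (poly (hermite_poly n) x) * w x) / hermite_norm n)"
      by (simp add: hermite_fun_eq w_def mult.assoc)
    then have "L (hermite_poly n) / hermite_norm n = 0" using zero[of n] by (simp add: L_def)
    then show ?case using hermite_norm_pos[of n] by simp
  next
    case (Suc k)
    have "monom 1 (Suc k) * hermite_poly n =
        smult (1/2) (monom 1 k * hermite_poly (Suc n)) + smult (real n) (monom 1 k * hermite_poly (n
            - 1))"
      by (rule poly_ext) (simp add: hermite_poly_rec poly_monom algebra_simps del:
          hermite_poly.simps)
    then show ?case by (simp only: L_add L_smult Suc.IH) simp
  qed
  from this[of _ 0] have mom: "(\<integral>x. of_real (x ^ k) * w x \<partial>lborel) = 0" for k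
    by (simp add: L_def poly_monom)
  have "AE x in lborel. w x = 0"
  proof (rule AE_zero_if_char_zero)
    show "integrable lborel w" using mono[of 0] by simp
    fix t
    \<comment> \<open>The truncated series of exp (i t x) times \<open>w\<close>; each
      \<open>s N\<close> is a combination of moments and integrates to 0.\<close>
    define s where "s N x = (\<Sum>k<N. (\<i> * of_real t) ^ k / fact k * (of_real (x ^ k) * w x))" for N x
    have s_eq: "s N x = (\<Sum>k<N. (\<i> * of_real (t * x)) ^ k /\<^sub>R fact k) * w x" for N x
      unfolding s_def sum_distrib_right
      by (intro sum.cong) (auto simp: power_mult_distrib scaleR_conv_of_real field_simps)
    have s0: "integral\<^sup>L lborel (s N) = 0" for N
      unfolding s_def[abs_def] using mono mom
      by (subst Bochner_Integration.integral_sum) (auto intro!: integrable_mult_right simp del: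
          of_real_power)
    have "(\<lambda>N. integral\<^sup>L lborel (s N)) \<longlonglongrightarrow> (\<integral>x. iexp (t * x) * w x \<partial>lborel)"
    proof (rule integral_dominated_convergence)
      show "integrable lborel (\<lambda>x. exp (\<bar>t\<bar> * \<bar>x\<bar>) * cmod (w x))" by (rule bnd')
      show "AE x in lborel. (\<lambda>N. s N x) \<longlonglongrightarrow> iexp (t * x) * w x"
        unfolding s_eq exp_def
        by (intro AE_I2 tendsto_mult tendsto_const summable_LIMSEQ summable_exp_generic)
      show "AE x in lborel. norm (s N x) \<le> exp (\<bar>t\<bar> * \<bar>x\<bar>) * cmod (w x)" for N
      proof (rule AE_I2)
        fix x
        have "norm (\<Sum>k<N. (\<i> * of_real (t * x)) ^ k /\<^sub>R fact k) \<le> (\<Sum>k<N. \<bar>t * x\<bar> ^ k /\<^sub>R fact k)"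
          by (rule sum_norm_le) (simp add: norm_power norm_mult abs_mult)
        also have "\<dots> \<le> exp \<bar>t * x\<bar>"
          unfolding exp_def by (intro sum_le_suminf summable_exp_generic) auto
        finally show "norm (s N x) \<le> exp (\<bar>t\<bar> * \<bar>x\<bar>) * cmod (w x)"
          unfolding s_eq norm_mult by (intro mult_right_mono) (auto simp: abs_mult)
      qed
      show "s N \<in> borel_measurable lborel" for N unfolding s_def[abs_def] by measurable
    qed measurable
    then show "(\<integral>x. iexp (t * x) * w x \<partial>lborel) = 0"
      unfolding s0 by (simp add: LIMSEQ_const_iff)
  qed
  then show ?thesis by (simp add: w_def)
qed

subsection \<open>The Fourier transform on square integrable functions\<close>

text \<open>The hypotheses of \<open>hermite_complete\<close> as a class closed under differences.
  It contains both the square integrable and the bounded functions, so a function of one kind can be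
  compared with one of the other.\<close>

definition gauss_tempered :: "(real \<Rightarrow> complex) \<Rightarrow> bool" where
  "gauss_tempered h \<longleftrightarrow> h \<in> borel_measurable borel \<and>
     (\<forall>a. integrable lborel (\<lambda>x. exp (a * \<bar>x\<bar>) * exp (- x\<^sup>2 / 2) * cmod (h x)))"

lemma integrable_exp_abs_gauss: "integrable lborel (\<lambda>x::real. exp (a * \<bar>x\<bar>) * exp (- x\<^sup>2 / 2))"
proof (rule Bochner_Integration.integrable_bound)
  have "exp (b * x) * exp (- x\<^sup>2 / 2) = exp (b\<^sup>2 / 2) * sqrt (2 * pi) * normal_density b 1 x"
      for b x :: real
  proof -
    have "b * x + - x\<^sup>2 / 2 = b\<^sup>2 / 2 + - (x - b)\<^sup>2 / 2" by (simp add: power2_eq_square field_simps)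
    then show ?thesis by (simp add: normal_density_def flip: exp_add)
  qed
  then have "integrable lborel (\<lambda>x::real. exp (b * x) * exp (- x\<^sup>2 / 2))" for b by simp
  from this[of a] this[of "-a"]
  show "integrable lborel (\<lambda>x::real. exp (a * x) * exp (- x\<^sup>2 / 2) + exp (- a * x) * exp (- x\<^sup>2 / 2))"
    by (rule Bochner_Integration.integrable_add)
  have "exp (a * \<bar>x\<bar>) \<le> exp (a * x) + exp (- a * x)" for x :: real
    by (cases "x \<ge> 0") (auto simp: less_imp_le)
  then have "exp (a * \<bar>x\<bar>) * exp (- x\<^sup>2 / 2) \<le> (exp (a * x) + exp (- a * x)) * exp (- x\<^sup>2 / 2)"
      for x :: real
    by (intro mult_right_mono) auto
  then show "AE x in lborel. norm (exp (a * \<bar>x\<bar>) * exp (- x\<^sup>2 / 2)) \<le>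
      norm (exp (a * x) * exp (- x\<^sup>2 / 2) + exp (- a * x) * exp (- x\<^sup>2 / 2))"
    by (auto simp: distrib_right)
qed measurable

lemma gauss_tempered_bounded:
  assumes [measurable]: "h \<in> borel_measurable borel" and bnd: "\<And>x. cmod (h x) \<le> B"
  shows "gauss_tempered h"
  unfolding gauss_tempered_def
proof (intro conjI allI assms(1))
  fix a
  show "integrable lborel (\<lambda>x. exp (a * \<bar>x\<bar>) * exp (- x\<^sup>2 / 2) * cmod (h x))"
  proof (rule Bochner_Integration.integrable_bound)
    show "integrable lborel (\<lambda>x::real. exp (a * \<bar>x\<bar>) * exp (- x\<^sup>2 / 2) * B)"
      by (intro integrable_mult_left integrable_exp_abs_gauss)
    have "cmod (h x) \<le> \<bar>B\<bar>" for x using bnd[of x] by linarith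
    then show "AE x in lborel. norm (exp (a * \<bar>x\<bar>) * exp (- x\<^sup>2 / 2) * cmod (h x))
        \<le> norm (exp (a * \<bar>x\<bar>) * exp (- x\<^sup>2 / 2) * B)"
      by (auto simp: abs_mult intro!: mult_left_mono)
  qed measurable
qed

lemma gauss_tempered_square_integrable:
  assumes "square_integrable h"
  shows "gauss_tempered h"
proof -
  have [measurable]: "h \<in> borel_measurable borel" using assms by (rule square_integrable_measurable)
  have "integrable lborel (\<lambda>x. exp (a * \<bar>x\<bar>) * exp (- x\<^sup>2 / 2) * cmod (h x))" for a
  proof (rule Bochner_Integration.integrable_bound)
    \<comment> \<open>The majorant is e^2 + |h|^2 with \<open>e\<close> as below; squaring
      \<open>e\<close> doubles \<open>a\<close>, and exp (- x^2) is weakened to exp (- x^2 /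
      2).\<close>
    show "integrable lborel (\<lambda>x. exp ((2 * a) * \<bar>x\<bar>) * exp (- x\<^sup>2 / 2) + (cmod (h x))\<^sup>2)"
      using assms by (intro Bochner_Integration.integrable_add integrable_exp_abs_gauss) (simp add:
          square_integrable_def)
    have "exp (a * \<bar>x\<bar>) * exp (- x\<^sup>2 / 2) * cmod (h x)
        \<le> exp ((2 * a) * \<bar>x\<bar>) * exp (- x\<^sup>2 / 2) + (cmod (h x))\<^sup>2" for x
    proof -
      define e where "e = exp (a * \<bar>x\<bar>) * exp (- x\<^sup>2 / 2)"
      have "e\<^sup>2 = exp ((2 * a) * \<bar>x\<bar>) * exp (- x\<^sup>2)"
        unfolding e_def power2_eq_square by (simp flip: exp_add)
      also have "\<dots> \<le> exp ((2 * a) * \<bar>x\<bar>) * exp (- x\<^sup>2 / 2)" by (intro mult_left_mono) auto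
      finally have "e\<^sup>2 \<le> exp ((2 * a) * \<bar>x\<bar>) * exp (- x\<^sup>2 / 2)" .
      moreover have "2 * (e * cmod (h x)) \<le> e\<^sup>2 + (cmod (h x))\<^sup>2"
        using sum_squares_bound[of e "cmod (h x)"] by simp
      moreover have "0 \<le> e * cmod (h x)" by (simp add: e_def)
      ultimately show ?thesis unfolding e_def[symmetric] by linarith
    qed
    then show "AE x in lborel. norm (exp (a * \<bar>x\<bar>) * exp (- x\<^sup>2 / 2) * cmod (h x)) \<le>
        norm (exp ((2 * a) * \<bar>x\<bar>) * exp (- x\<^sup>2 / 2) + (cmod (h x))\<^sup>2)"
      by (auto simp: abs_mult)
  qed measurable
  then show ?thesis by (simp add: gauss_tempered_def)
qed

lemma gauss_tempered_hermite_integrable: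
  assumes "gauss_tempered h"
  shows "integrable lborel (\<lambda>x. of_real (hermite_fun n x) * h x)"
proof -
  have [measurable]: "h \<in> borel_measurable borel" using assms by (simp add: gauss_tempered_def)
  have m: "integrable lborel (\<lambda>x. of_real (x ^ k * exp (- x\<^sup>2 / 2)) * h x)" for k
  proof (rule Bochner_Integration.integrable_bound)
    show "integrable lborel (\<lambda>x. fact k * (exp (1 * \<bar>x\<bar>) * exp (- x\<^sup>2 / 2) * cmod (h x)))"
      using assms unfolding gauss_tempered_def by (intro integrable_mult_right) blast
    have "norm (of_real (x ^ k * exp (- x\<^sup>2 / 2)) * h x)
        \<le> norm (fact k * (exp (1 * \<bar>x\<bar>) * exp (- x\<^sup>2 / 2) * cmod (h x)))" for x
      using mult_right_mono[OF abs_power_le_exp[of x k], of "exp (- x\<^sup>2 / 2) * cmod (h x)"]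
      by (simp add: norm_mult norm_power power_abs abs_mult mult.assoc)
    then show "AE x in lborel. norm (of_real (x ^ k * exp (- x\<^sup>2 / 2)) * h x)
        \<le> norm (fact k * (exp (1 * \<bar>x\<bar>) * exp (- x\<^sup>2 / 2) * cmod (h x)))"
      by simp
  qed measurable
  have "(\<lambda>x. of_real (hermite_fun n x) * h x) = (\<lambda>x. \<Sum>i\<le>degree (hermite_poly n).
      of_real (coeff (hermite_poly n) i / hermite_norm n) * (of_real (x ^ i * exp (- x\<^sup>2 / 2)) * h
          x))"
    by (simp add: hermite_fun_eq poly_altdef sum_distrib_right sum_divide_distrib mult.assoc
        fun_eq_iff)
  then show ?thesis
    using m by (auto intro!: Bochner_Integration.integrable_sum integrable_mult_right simp del:
        of_real_power of_real_mult)
qed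

lemma gauss_tempered_diff:
  assumes "gauss_tempered f" "gauss_tempered g"
  shows "gauss_tempered (\<lambda>x. f x - g x)"
proof -
  have [measurable]: "f \<in> borel_measurable borel" "g \<in> borel_measurable borel"
    using assms by (auto simp: gauss_tempered_def)
  have "integrable lborel (\<lambda>x. exp (a * \<bar>x\<bar>) * exp (- x\<^sup>2 / 2) * cmod (f x - g x))" for a
  proof (rule Bochner_Integration.integrable_bound)
    show "integrable lborel (\<lambda>x. exp (a * \<bar>x\<bar>) * exp (- x\<^sup>2 / 2) * cmod (f x)
        + exp (a * \<bar>x\<bar>) * exp (- x\<^sup>2 / 2) * cmod (g x))"
      using assms unfolding gauss_tempered_def by (intro Bochner_Integration.integrable_add) blast+
    have "exp (a * \<bar>x\<bar>) * exp (- x\<^sup>2 / 2) * cmod (f x - g x)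
        \<le> exp (a * \<bar>x\<bar>) * exp (- x\<^sup>2 / 2) * (cmod (f x) + cmod (g x))" for x
      by (intro mult_left_mono norm_triangle_ineq4) auto
    then show "AE x in lborel. norm (exp (a * \<bar>x\<bar>) * exp (- x\<^sup>2 / 2) * cmod (f x - g x)) \<le>
        norm (exp (a * \<bar>x\<bar>) * exp (- x\<^sup>2 / 2) * cmod (f x)
            + exp (a * \<bar>x\<bar>) * exp (- x\<^sup>2 / 2) * cmod (g x))"
      by (auto simp: abs_mult distrib_left)
  qed measurable
  then show ?thesis by (simp add: gauss_tempered_def)
qed

lemma AE_eq_if_hermite_coeff_eq:
  assumes f: "gauss_tempered f" and g: "gauss_tempered g"
    and eq: "\<And>n. hermite_coeff f n = hermite_coeff g n"
  shows "AE x in lborel. f x = g x"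
proof -
  have fg: "gauss_tempered (\<lambda>x. f x - g x)" by (rule gauss_tempered_diff[OF f g])
  have "AE x in lborel. f x - g x = 0"
  proof (rule hermite_complete)
    show "(\<integral>x. of_real (hermite_fun n x) * (f x - g x) \<partial>lborel) = 0" for n
      using eq[of n] gauss_tempered_hermite_integrable[OF f, of n]
          gauss_tempered_hermite_integrable[OF g, of n]
      by (simp add: right_diff_distrib hermite_coeff_def)
  qed (use fg in \<open>auto simp: gauss_tempered_def\<close>)
  then show ?thesis by simp
qed

text \<open>The Riesz-Fischer function built from the coefficients of \<open>f\<close> is
  \<open>f\<close> itself almost everywhere, by completeness. So the Hermite sums converge to
  \<open>f\<close> in mean square, and the defect in Bessel's inequality tends to 0.\<close>

lemma hermite_Parseval:
  assumes f: "square_integrable f"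
  shows "(\<lambda>n. (cmod (hermite_coeff f n))\<^sup>2) sums (\<integral>x. (cmod (f x))\<^sup>2 \<partial>lborel)"
proof -
  obtain T where T: "square_integrable T" "\<And>n. hermite_coeff T n = hermite_coeff f n"
    and lim: "(\<lambda>N. \<integral>x. (cmod (T x - hermite_sum (hermite_coeff f) {..<N} x))\<^sup>2 \<partial>lborel) \<longlonglongrightarrow> 0"
    using hermite_Riesz_Fischer[OF summable_hermite_coeff[OF f]] by blast
  have coeff_eq: "hermite_coeff T = hermite_coeff f" using T(2) by auto
  have "AE x in lborel. T x = f x"
    using T f by (intro AE_eq_if_hermite_coeff_eq gauss_tempered_square_integrable) auto
  then have "(\<integral>x. (cmod (f x))\<^sup>2 \<partial>lborel) = (\<integral>x. (cmod (T x))\<^sup>2 \<partial>lborel)"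
    using T(1) f by (intro integral_cong_AE) (auto simp: square_integrable_def)
  moreover have "(\<lambda>N. (\<integral>x. (cmod (T x))\<^sup>2 \<partial>lborel) - (\<integral>x. (cmod (T x
      - hermite_sum (hermite_coeff f) {..<N} x))\<^sup>2 \<partial>lborel))
      \<longlonglongrightarrow> (\<integral>x. (cmod (T x))\<^sup>2 \<partial>lborel) - 0"
    by (intro tendsto_diff tendsto_const lim)
  ultimately show ?thesis
    using L2_distance_hermite_partial_sum[OF T(1)] by (simp add: sums_def coeff_eq)
qed

section \<open>Fourier integrals of integrable functions\<close>

lemma fourier_integral_measurable [measurable]:
  assumes [measurable]: "g \<in> borel_measurable borel"
  shows "fourier_integral g \<in> borel_measurable borel"
proof -
  have "(\<lambda>\<xi>. LINT x|lborel. exp (- \<i> * of_real (\<xi> * x)) * g x) \<in> borel_measurable borel"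
    by (rule sigma_finite_measure.borel_measurable_lebesgue_integral[OF sigma_finite_lborel])
        measurable
  then show ?thesis unfolding fourier_integral_def[abs_def] by measurable
qed

lemma norm_fourier_integral_le:
  "cmod (fourier_integral g \<xi>) \<le> 1 / sqrt (2 * pi) * (\<integral>x. cmod (g x) \<partial>lborel)"
proof -
  have "cmod (LINT x|lborel. exp (- \<i> * of_real (\<xi> * x)) * g x)
      \<le> (\<integral>x. cmod (exp (- \<i> * of_real (\<xi> * x)) * g x) \<partial>lborel)"
    by (rule integral_norm_bound)
  also have "\<dots> = (\<integral>x. cmod (g x) \<partial>lborel)" by (simp add: norm_mult)
  finally show ?thesis unfolding fourier_integral_def norm_mult
    by (intro mult_mono) (auto simp: norm_divide)
qed

text \<open>The kernel exp (- i x y) is symmetric and of modulus 1, so the double integrand is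
  dominated by |f x| |g y| and Fubini's theorem applies.\<close>

lemma fourier_integral_multiplication_formula:
  assumes f: "integrable lborel f" and g: "integrable lborel g"
  shows "(\<integral>x. f x * fourier_integral g x \<partial>lborel) = (\<integral>x. fourier_integral f x * g x \<partial>lborel)"
proof -
  have [measurable]: "f \<in> borel_measurable borel" "g \<in> borel_measurable borel" using f g by auto
  define K where "K x y = exp (- \<i> * of_real (x * y)) * f x * g y" for x y
  have [measurable]: "case_prod K \<in> borel_measurable (lborel \<Otimes>\<^sub>M lborel)"
    unfolding K_def[abs_def] by measurable
  have nK: "norm (K x y) = cmod (f x) * cmod (g y)" for x y
    by (simp add: K_def norm_mult)
  have Kg: "integrable lborel (\<lambda>y. exp (- \<i> * of_real (x * y)) * g y)" for x
    by (rule integrable_fourier_kernel[OF g])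
  have "integrable (lborel \<Otimes>\<^sub>M lborel) (case_prod K)"
  proof (rule lborel_pair.Fubini_integrable)
    show "integrable lborel (\<lambda>x. \<integral>y. norm (case (x, y) of (x, y) \<Rightarrow> K x y) \<partial>lborel)"
      using f by (simp add: nK)
    show "AE x in lborel. integrable lborel (\<lambda>y. case (x, y) of (x, y) \<Rightarrow> K x y)"
      using integrable_mult_right[OF Kg] by (auto simp: K_def mult.assoc mult.left_commute[of _ "f
          _"])
  qed measurable
  then have "(\<integral>y. \<integral>x. K x y \<partial>lborel \<partial>lborel) = (\<integral>x. \<integral>y. K x y \<partial>lborel \<partial>lborel)"
    by (rule lborel_pair.Fubini_integral)
  moreover have "(\<integral>y. K x y \<partial>lborel) = sqrt (2 * pi) * (f x * fourier_integral g x)" for x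
  proof -
    have "(\<integral>y. K x y \<partial>lborel) = (\<integral>y. f x * (exp (- \<i> * of_real (x * y)) * g y) \<partial>lborel)"
      by (simp add: K_def ac_simps)
    then show ?thesis by (simp add: fourier_integral_def)
  qed
  moreover have "(\<integral>x. K x y \<partial>lborel) = sqrt (2 * pi) * (fourier_integral f y * g y)" for y
  proof -
    have "(\<integral>x. K x y \<partial>lborel) = (\<integral>x. (exp (- \<i> * of_real (y * x)) * f x) * g y \<partial>lborel)"
      by (simp add: K_def ac_simps)
    then show ?thesis by (simp add: fourier_integral_def)
  qed
  ultimately show ?thesis by simp
qed

text \<open>The transform passes to the Hermite function, whose eigenvalue is (- i)^n. The Fourier
  integral on the left is at this point only known to be bounded.\<close>

lemma hermite_coeff_fourier_integral:
  assumes "integrable lborel g"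
  shows "hermite_coeff (fourier_integral g) n = (- \<i>) ^ n * hermite_coeff g n"
proof -
  have "hermite_coeff (fourier_integral g) n = (\<integral>x. fourier_integral (\<lambda>x. of_real (hermite_fun n x))
      x * g x \<partial>lborel)"
    unfolding hermite_coeff_def
    by (intro fourier_integral_multiplication_formula integrable_of_real integrable_hermite_fun
        assms)
  then show ?thesis by (simp add: fourier_integral_hermite_fun hermite_coeff_def mult.assoc)
qed

lemma hermite_Riesz_Fischer_fourier:
  assumes "square_integrable g"
  obtains T where "square_integrable T" "\<And>n. hermite_coeff T n = (- \<i>) ^ n * hermite_coeff g n"
proof -
  have "summable (\<lambda>n. (cmod ((- \<i>) ^ n * hermite_coeff g n))\<^sup>2)"
    using summable_hermite_coeff[OF assms] by (simp add: norm_mult norm_power)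
  then show ?thesis by (rule hermite_Riesz_Fischer) (rule that)
qed

lemma square_integrable_fourier_integral:
  assumes g: "integrable lborel g" "square_integrable g"
  shows "square_integrable (fourier_integral g)"
proof -
  have [measurable]: "g \<in> borel_measurable borel" using g by auto
  obtain T where T: "square_integrable T" "\<And>n. hermite_coeff T n = (- \<i>) ^ n * hermite_coeff g n"
    using hermite_Riesz_Fischer_fourier[OF g(2)] by blast
  have [measurable]: "T \<in> borel_measurable borel" using T(1) by (rule square_integrable_measurable)
  have "gauss_tempered (fourier_integral g)"
    by (rule gauss_tempered_bounded[OF _ norm_fourier_integral_le]) measurable
  then have "AE x in lborel. T x = fourier_integral g x"
    by (rule AE_eq_if_hermite_coeff_eq[OF gauss_tempered_square_integrable[OF T(1)]])
      (simp add: hermite_coeff_fourier_integral g T(2))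
  then have "AE x in lborel. (cmod (T x))\<^sup>2 = (cmod (fourier_integral g x))\<^sup>2" by auto
  then have "integrable lborel (\<lambda>x. (cmod (fourier_integral g x))\<^sup>2)"
    by (subst integrable_cong_AE[symmetric, where f="\<lambda>x. (cmod (T x))\<^sup>2"]) (use T in \<open>auto simp:
        square_integrable_def\<close>)
  then show ?thesis by (simp add: square_integrable_def)
qed

section \<open>Classes of square integrable functions and their representatives\<close>

lemma L2_eq_refl: "square_integrable f \<Longrightarrow> L2_eq f f"
  by (simp add: L2_eq_def)

lemma square_integrable_rep_L2: "square_integrable (rep_L2 \<phi>)"
  using Quotient3_rep_reflp[OF Quotient3_L2, of \<phi>] by (simp add: L2_eq_def)

lemma rep_abs_L2_AE: "square_integrable f \<Longrightarrow> AE x in lborel. rep_L2 (abs_L2 f) x = f x"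
  using rep_abs_rsp_left[OF Quotient3_L2 L2_eq_refl, of f] by (simp add: L2_eq_def)

lemma L2_eqI: "(AE x in lborel. rep_L2 \<phi> x = rep_L2 \<psi> x) \<Longrightarrow> \<phi> = \<psi>"
  using Quotient3_rel_rep[OF Quotient3_L2, of \<phi> \<psi>] by (simp add: L2_eq_def square_integrable_rep_L2)

lemma hermite_coeff_rep_abs_L2:
  "square_integrable f \<Longrightarrow> hermite_coeff (rep_L2 (abs_L2 f)) = hermite_coeff f"
  by (intro ext hermite_coeff_cong_AE rep_abs_L2_AE square_integrable_measurable
      square_integrable_rep_L2)

lemma L2_eqI_hermite_coeff:
  "(\<And>n. hermite_coeff (rep_L2 \<phi>) n = hermite_coeff (rep_L2 \<psi>) n) \<Longrightarrow> \<phi> = \<psi>"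
  by (intro L2_eqI AE_eq_if_hermite_coeff_eq gauss_tempered_square_integrable
      square_integrable_rep_L2)

section \<open>Truncations and limits in mean square\<close>

lemma square_integrable_truncate:
  assumes f: "square_integrable f"
  shows "square_integrable (\<lambda>x. indicator {-R..R} x * f x)"
    and "integrable lborel (\<lambda>x. indicator {-R..R::real} x * f x)"
proof -
  have [measurable]: "f \<in> borel_measurable borel" using f by (rule square_integrable_measurable)
  have sq: "integrable lborel (\<lambda>x. indicator {-R..R} x * (cmod (f x))\<^sup>2)"
    using f integrable_mult_indicator[of "{-R..R}" lborel "\<lambda>x. (cmod (f x))\<^sup>2"]
    by (simp add: square_integrable_def)
  also have "(\<lambda>x. indicator {-R..R} x * (cmod (f x))\<^sup>2) = (\<lambda>x. (cmod (indicator {-R..R} x * f x))\<^sup>2)"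
    by (auto simp: indicator_def fun_eq_iff)
  finally show *: "square_integrable (\<lambda>x. indicator {-R..R} x * f x)"
    by (simp add: square_integrable_def)
  \<comment> \<open>The indicator of a bounded interval is itself square integrable, so the
    truncation is integrable as a product of two square integrable functions.\<close>
  have "square_integrable (\<lambda>x. indicator {-R..R} x)"
    unfolding square_integrable_def
  proof
    have "integrable lborel (\<lambda>x. indicator {-R..R} x :: real)"
      by (rule integrable_real_indicator) (auto simp: emeasure_lborel_Icc_eq)
    also have "(\<lambda>x. indicator {-R..R} x :: real) = (\<lambda>x. (cmod (indicator {-R..R} x))\<^sup>2)"
      by (auto simp: indicator_def)
    finally show "integrable lborel (\<lambda>x. (cmod (indicator {-R..R} x))\<^sup>2)" .
  qed measurable
  from square_integrable_mult_integrable[OF this f]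
  show "integrable lborel (\<lambda>x. indicator {-R..R} x * f x)" .
qed

lemma tendsto_truncate_L2:
  assumes f: "square_integrable f"
  shows "((\<lambda>R. \<integral>x. (cmod (indicator {-R..R} x * f x - f x))\<^sup>2 \<partial>lborel) \<longlongrightarrow> 0) at_top"
proof -
  have [measurable]: "f \<in> borel_measurable borel" using f by (rule square_integrable_measurable)
  have "((\<lambda>R. \<integral>x. (cmod (indicator {-R..R} x * f x - f x))\<^sup>2 \<partial>lborel)
      \<longlongrightarrow> (\<integral>x. 0 \<partial>(lborel :: real measure))) at_top"
  proof (rule integral_dominated_convergence_at_top)
    show "integrable lborel (\<lambda>x. (cmod (f x))\<^sup>2)" using f by (simp add: square_integrable_def)
    show "AE x in lborel. ((\<lambda>R. (cmod (indicator {-R..R} x * f x - f x))\<^sup>2) \<longlongrightarrow> 0) at_top"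
    proof (rule AE_I2)
      fix x :: real
      have "eventually (\<lambda>R. 0 = (cmod (indicator {-R..R} x * f x - f x))\<^sup>2) at_top"
        using eventually_ge_at_top[of "\<bar>x\<bar>"] by eventually_elim (auto simp: indicator_def)
      then show "((\<lambda>R. (cmod (indicator {-R..R} x * f x - f x))\<^sup>2) \<longlongrightarrow> 0) at_top"
        by (rule Lim_transform_eventually[OF tendsto_const])
    qed
    show "eventually (\<lambda>R. AE x in lborel. norm ((cmod (indicator {-R..R} x * f x - f x))\<^sup>2)
        \<le> (cmod (f x))\<^sup>2) at_top"
      by (intro always_eventually allI AE_I2) (auto simp: indicator_def)
  qed measurable
  then show ?thesis by simp
qed

text \<open>The uniqueness half of the definite description in \<open>fourier_L2\<close>, stated for
  nonnegative integrals as there. The inequality |g - h|^2 \<le> 2 |F - g|^2 + 2 |F - h|^2 replaces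
  the triangle inequality of the norm.\<close>

lemma L2_limit_unique:
  assumes [measurable]: "\<And>R. F R \<in> borel_measurable borel" "g \<in> borel_measurable borel" "h \<in>
      borel_measurable borel"
    and g: "((\<lambda>R::real. \<integral>\<^sup>+x. ennreal ((cmod (F R x - g x))\<^sup>2) \<partial>lborel) \<longlongrightarrow> 0) at_top"
    and h: "((\<lambda>R::real. \<integral>\<^sup>+x. ennreal ((cmod (F R x - h x))\<^sup>2) \<partial>lborel) \<longlongrightarrow> 0) at_top"
  shows "AE x in lborel. g x = h (x::real)"
proof -
  have le: "(\<integral>\<^sup>+x. ennreal ((cmod (g x - h x))\<^sup>2) \<partial>lborel) \<le>
      2 * (\<integral>\<^sup>+x. ennreal ((cmod (F R x - g x))\<^sup>2) \<partial>lborel) + 2 * (\<integral>\<^sup>+x. ennreal ((cmod (F R x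
          - h x))\<^sup>2) \<partial>lborel)" for R
  proof -
    have "(cmod (g x - h x))\<^sup>2 \<le> 2 * (cmod (F R x - g x))\<^sup>2 + 2 * (cmod (F R x - h x))\<^sup>2" for x
    proof -
      have "(cmod (g x - h x))\<^sup>2 = (cmod ((F R x - h x) - (F R x - g x)))\<^sup>2" by simp
      also have "\<dots> \<le> (cmod (F R x - h x) + cmod (F R x - g x))\<^sup>2"
        by (intro power_mono norm_triangle_ineq4) auto
      also have "\<dots> \<le> 2 * (cmod (F R x - g x))\<^sup>2 + 2 * (cmod (F R x - h x))\<^sup>2"
        using sum_squares_bound[of "cmod (F R x - h x)" "cmod (F R x - g x)"]
          by (simp add: power2_sum)
      finally show ?thesis .
    qed
    then have "ennreal ((cmod (g x - h x))\<^sup>2) \<le> 2 * ennreal ((cmod (F R x - g x))\<^sup>2)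
        + 2 * ennreal ((cmod (F R x - h x))\<^sup>2)" for x
      by (simp add: ennreal_mult'[symmetric] ennreal_plus[symmetric] ennreal_leI flip:
          ennreal_numeral del: ennreal_plus)
    then have "(\<integral>\<^sup>+x. ennreal ((cmod (g x - h x))\<^sup>2) \<partial>lborel) \<le>
        (\<integral>\<^sup>+x. (2 * ennreal ((cmod (F R x - g x))\<^sup>2) + 2 * ennreal ((cmod (F R x - h x))\<^sup>2)) \<partial>lborel)"
      by (intro nn_integral_mono)
    also have "\<dots> = 2 * (\<integral>\<^sup>+x. ennreal ((cmod (F R x - g x))\<^sup>2) \<partial>lborel)
        + 2 * (\<integral>\<^sup>+x. ennreal ((cmod (F R x - h x))\<^sup>2) \<partial>lborel)"
      by (subst nn_integral_add) (auto simp: nn_integral_cmult)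
    finally show ?thesis .
  qed
  have "((\<lambda>R. 2 * (\<integral>\<^sup>+x. ennreal ((cmod (F R x - g x))\<^sup>2) \<partial>lborel) + 2 * (\<integral>\<^sup>+x. ennreal ((cmod (F R x
      - h x))\<^sup>2) \<partial>lborel))
      \<longlongrightarrow> 2 * 0 + 2 * 0) at_top"
    by (intro tendsto_add ennreal_tendsto_cmult g h) auto
  then have "(\<integral>\<^sup>+x. ennreal ((cmod (g x - h x))\<^sup>2) \<partial>lborel) \<le> 2 * 0 + 2 * 0"
    by (rule tendsto_lowerbound[OF _ always_eventually]) (auto intro: le)
  then have "(\<integral>\<^sup>+x. ennreal ((cmod (g x - h x))\<^sup>2) \<partial>lborel) = 0" by simp
  then show ?thesis by (subst (asm) nn_integral_0_iff_AE) auto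
qed

lemma hermite_coeff_fourier_L2:
  "hermite_coeff (rep_L2 (fourier_L2 \<phi>)) n = (- \<i>) ^ n * hermite_coeff (rep_L2 \<phi>) n"
proof -
  define f where "f = rep_L2 \<phi>"
  have f: "square_integrable f" unfolding f_def by (rule square_integrable_rep_L2)
  have [measurable]: "f \<in> borel_measurable borel" using f by (rule square_integrable_measurable)
  obtain T where T: "square_integrable T" "\<And>n. hermite_coeff T n = (- \<i>) ^ n * hermite_coeff f n"
    using hermite_Riesz_Fischer_fourier[OF f] by blast
  define \<psi> where "\<psi> = abs_L2 T"
  have \<psi>: "hermite_coeff (rep_L2 \<psi>) n = (- \<i>) ^ n * hermite_coeff f n" for n
    using T by (simp add: \<psi>_def hermite_coeff_rep_abs_L2)
  let ?F = "\<lambda>R. fourier_integral (\<lambda>x. indicator {-R..R} x * f x)"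
  have F: "square_integrable (?F R)" for R
    by (intro square_integrable_fourier_integral square_integrable_truncate f)
  \<comment> \<open>Corresponding coefficients of the two differences have equal modulus, so
    Parseval yields an equality rather than an estimate.\<close>
  have dist: "(\<integral>\<^sup>+\<xi>. ennreal ((cmod (?F R \<xi> - rep_L2 \<psi> \<xi>))\<^sup>2) \<partial>lborel)
      = ennreal (\<integral>x. (cmod (indicator {-R..R} x * f x - f x))\<^sup>2 \<partial>lborel)" for R
  proof -
    have u: "square_integrable (\<lambda>\<xi>. ?F R \<xi> - rep_L2 \<psi> \<xi>)"
      by (intro square_integrable_diff F square_integrable_rep_L2)
    have v: "square_integrable (\<lambda>x. indicator {-R..R} x * f x - f x)"
      by (intro square_integrable_diff square_integrable_truncate f)
    have "hermite_coeff (\<lambda>\<xi>. ?F R \<xi> - rep_L2 \<psi> \<xi>) n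
        = (- \<i>) ^ n * hermite_coeff (\<lambda>x. indicator {-R..R} x * f x - f x) n" for n
      by (simp add: hermite_coeff_diff F f square_integrable_rep_L2 square_integrable_truncate
          hermite_coeff_fourier_integral \<psi> right_diff_distrib)
    then have "cmod (hermite_coeff (\<lambda>\<xi>. ?F R \<xi> - rep_L2 \<psi> \<xi>) n)
        = cmod (hermite_coeff (\<lambda>x. indicator {-R..R} x * f x - f x) n)" for n
      by (simp add: norm_mult norm_power)
    then have "(\<integral>\<xi>. (cmod (?F R \<xi> - rep_L2 \<psi> \<xi>))\<^sup>2 \<partial>lborel)
        = (\<integral>x. (cmod (indicator {-R..R} x * f x - f x))\<^sup>2 \<partial>lborel)"
      using hermite_Parseval[OF u] hermite_Parseval[OF v] by (auto intro: sums_unique2)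
    moreover have "(\<integral>\<^sup>+\<xi>. ennreal ((cmod (?F R \<xi> - rep_L2 \<psi> \<xi>))\<^sup>2) \<partial>lborel)
        = ennreal (\<integral>\<xi>. (cmod (?F R \<xi> - rep_L2 \<psi> \<xi>))\<^sup>2 \<partial>lborel)"
      using u by (intro nn_integral_eq_integral) (auto simp: square_integrable_def)
    ultimately show ?thesis by simp
  qed
  have lim: "((\<lambda>R. \<integral>\<^sup>+\<xi>. ennreal ((cmod (?F R \<xi> - rep_L2 \<psi> \<xi>))\<^sup>2) \<partial>lborel) \<longlongrightarrow> 0) at_top"
    unfolding dist using tendsto_ennrealI[OF tendsto_truncate_L2[OF f]] by simp
  have "fourier_L2 \<phi> = \<psi>"
    unfolding fourier_L2_def f_def[symmetric]
  proof (rule the_equality)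
    show "((\<lambda>R. \<integral>\<^sup>+\<xi>. ennreal ((cmod (?F R \<xi> - rep_L2 \<psi> \<xi>))\<^sup>2) \<partial>lborel) \<longlongrightarrow> 0) at_top" by (rule lim)
    fix \<psi>'
    assume "((\<lambda>R. \<integral>\<^sup>+\<xi>. ennreal ((cmod (?F R \<xi> - rep_L2 \<psi>' \<xi>))\<^sup>2) \<partial>lborel) \<longlongrightarrow> 0) at_top"
    from L2_limit_unique[OF _ _ _ this lim]
    show "\<psi>' = \<psi>"
      by (intro L2_eqI) (auto intro: square_integrable_measurable square_integrable_rep_L2 F)
  qed
  then show ?thesis using \<psi> by (simp add: f_def)
qed

subsection \<open>The Mittag-Leffler Bargmann transform\<close>

text \<open>Euler's integral restricted to t \<ge> M, where the power is at least
  \<open>M powr (s - 1)\<close>, leaves the tail of exp (- t), which is exp (- M). The free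
  parameter \<open>M\<close> is what lets Gamma (q n + 1) be compared with any geometric
  sequence.\<close>

lemma Gamma_ge_powr:
  assumes "s \<ge> 1" "M > (0::real)"
  shows "M powr (s - 1) * exp (- M) \<le> Gamma s"
proof (rule has_integral_le)
  have "((\<lambda>t. M powr (s - 1) * exp (- 1 * t)) has_integral M powr (s
      - 1) * (exp (- 1 * M) / 1)) {M..}"
    by (intro has_integral_mult_right has_integral_exp_minus_to_infinity) simp
  then show "((\<lambda>t. if t \<in> {M..} then M powr (s - 1) * exp (- 1 * t) else 0) has_integral M powr (s
      - 1) * exp (- M)) {0..}"
    using assms by (subst has_integral_restrict) auto
  show "((\<lambda>t. t powr (s - 1) / exp t) has_integral Gamma s) {0..}"
    using assms by (intro Gamma_integral_real) simp
  show "(if t \<in> {M..} then M powr (s - 1) * exp (- 1 * t) else 0) \<le> t powr (s - 1) / exp t" for t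
    using assms by (auto simp: exp_minus divide_inverse intro!: powr_mono2)
qed

text \<open>The norm of the monomial z^n in the Mittag-Leffler space; division by it turns the
  monomials into an orthonormal basis.\<close>

definition mittag_weight :: "real \<Rightarrow> nat \<Rightarrow> real" where
  "mittag_weight q n = sqrt (Gamma (q * real n + 1))"

lemma mittag_weight_pos: "q > 0 \<Longrightarrow> mittag_weight q n > 0"
  by (auto simp: mittag_weight_def intro!: Gamma_real_pos add_nonneg_pos)

lemma summable_mittag_weight:
  assumes "q > 0"
  shows "summable (\<lambda>n. norm (z ^ n / of_real (mittag_weight q n) :: complex))"
proof -
  \<comment> \<open>The factor 2 leaves the ratio 1/2 for the geometric comparison; adding 1 keeps
    \<open>r\<close> positive when \<open>z = 0\<close>.\<close>
  define r where "r = 2 * (norm z + 1)"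
  have "r > 0" by (simp add: r_def add_nonneg_pos)
  \<comment> \<open>The exponent is chosen so that \<open>M powr (q * real n)\<close> equals
    (r^n)^2, the square matching the root in the weight.\<close>
  define M where "M = r powr (2 / q)"
  have "M > 0" using \<open>r > 0\<close> by (simp add: M_def)
  have w: "r ^ n * exp (- M / 2) \<le> mittag_weight q n" for n
  proof -
    have "(r ^ n * exp (- M / 2))\<^sup>2 = M powr (q * real n) * exp (- M)"
    proof -
      have "M powr (q * real n) = r powr (2 * real n)"
        using assms by (simp add: M_def powr_powr)
      also have "\<dots> = (r ^ n)\<^sup>2"
        using \<open>r > 0\<close> powr_realpow[of r "2 * n"]
          by (simp add: power_mult mult.commute power_even_eq)
      finally show ?thesis by (simp add: power_mult_distrib power2_eq_square[of "exp _"] flip: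
          exp_add)
    qed
    also have "\<dots> \<le> Gamma (q * real n + 1)"
      using Gamma_ge_powr[of "q * real n + 1" M] assms \<open>M > 0\<close> by simp
    finally show ?thesis unfolding mittag_weight_def by (rule real_le_rsqrt)
  qed
  show ?thesis
  proof (rule summable_comparison_test')
    show "summable (\<lambda>n. exp (M / 2) * (1 / 2) ^ n :: real)"
      by (intro summable_mult summable_geometric) simp
    fix n
    have "norm z ^ n \<le> (r / 2) ^ n" by (intro power_mono) (auto simp: r_def)
    also have "\<dots> = exp (M / 2) * (1 / 2) ^ n * (r ^ n * exp (- M / 2))"
      by (simp add: power_divide exp_minus)
    also have "\<dots> \<le> exp (M / 2) * (1 / 2) ^ n * mittag_weight q n"
      by (intro mult_left_mono w) auto
    finally show "norm (norm (z ^ n / of_real (mittag_weight q n))) \<le> exp (M / 2) * (1 / 2) ^ n"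
      using mittag_weight_pos[OF assms, of n] by (simp add: norm_divide norm_power field_simps)
  qed
qed

text \<open>Termwise integration: the L^1 norms of the terms are at most
  \<open>norm (b n) * K\<close> with \<open>K\<close> independent of \<open>n\<close>. The bound
  comes from a b \<le> a^2 + b^2; the summand 1 in \<open>K\<close> is the squared norm of the
  Hermite function.\<close>

lemma hermite_series_mult_sums:
  assumes f: "square_integrable f" and b: "summable (\<lambda>n. norm (b n))"
  shows "(\<lambda>n. b n * hermite_coeff f n) sums (LINT x|lborel. cnj (\<Sum>n. cnj (b n) * of_real
      (hermite_fun n x)) * f x)"
proof -
  have [measurable]: "f \<in> borel_measurable borel" using f by (rule square_integrable_measurable)
  have [measurable]: "cnj \<in> borel_measurable borel"
    by (intro borel_measurable_continuous_onI continuous_intros)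
  define F where "F n x = b n * (of_real (hermite_fun n x) * f x)" for n x
  have [measurable]: "F n \<in> borel_measurable borel" for n unfolding F_def[abs_def] by measurable
  have F: "integrable lborel (F n)" for n
    unfolding F_def[abs_def]
    by (intro integrable_mult_right square_integrable_mult_integrable square_integrable_hermite_fun
        f)
  define K where "K = 1 + (\<integral>x. (cmod (f x))\<^sup>2 \<partial>lborel)"
  have K: "(\<integral>x. norm (F n x) \<partial>lborel) \<le> norm (b n) * K" for n
  proof -
    have h: "integrable lborel (\<lambda>x. (hermite_fun n x)\<^sup>2)"
      using integrable_hermite_fun_mult[of n n] by (simp add: power2_eq_square)
    have f2: "integrable lborel (\<lambda>x. (cmod (f x))\<^sup>2)" using f by (simp add: square_integrable_def)
    have *: "cmod (of_real (hermite_fun n x) * f x) \<le> (hermite_fun n x)\<^sup>2 + (cmod (f x))\<^sup>2" for x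
    proof -
      have "2 * (\<bar>hermite_fun n x\<bar> * cmod (f x)) \<le> (hermite_fun n x)\<^sup>2 + (cmod (f x))\<^sup>2"
        using sum_squares_bound[of "\<bar>hermite_fun n x\<bar>" "cmod (f x)"] by simp
      moreover have "0 \<le> \<bar>hermite_fun n x\<bar> * cmod (f x)" by simp
      ultimately have "\<bar>hermite_fun n x\<bar> * cmod (f x) \<le> (hermite_fun n x)\<^sup>2 + (cmod (f x))\<^sup>2"
        by linarith
      then show ?thesis by (simp add: norm_mult)
    qed
    have "(\<integral>x. cmod (of_real (hermite_fun n x) * f x) \<partial>lborel)
        \<le> (\<integral>x. (hermite_fun n x)\<^sup>2 + (cmod (f x))\<^sup>2 \<partial>lborel)"
      by (intro integral_mono * integrable_norm square_integrable_mult_integrable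
          square_integrable_hermite_fun f
          Bochner_Integration.integrable_add h f2)
    also have "\<dots> = K"
      using h f2 hermite_fun_orthonormal[of n n] by (simp add: K_def power2_eq_square)
    finally have "norm (b n) * (\<integral>x. cmod (of_real (hermite_fun n x) * f x) \<partial>lborel)
        \<le> norm (b n) * K"
      by (rule mult_left_mono) simp
    then show ?thesis by (simp add: F_def norm_mult)
  qed
  have summ: "summable (\<lambda>n. \<integral>x. norm (F n x) \<partial>lborel)"
    by (rule summable_comparison_test'[OF summable_mult2[OF b, of K]]) (use K in auto)
  have "(\<integral>\<^sup>+x. (\<Sum>n. ennreal (norm (F n x))) \<partial>lborel) = (\<Sum>n. \<integral>\<^sup>+x. ennreal (norm (F n x)) \<partial>lborel)"
    by (intro nn_integral_suminf) simp
  also have "\<dots> = (\<Sum>n. ennreal (\<integral>x. norm (F n x) \<partial>lborel))"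
    by (intro suminf_cong nn_integral_eq_integral integrable_norm F) simp
  also have "\<dots> < \<infinity>" by (subst suminf_ennreal2) (auto intro: summ)
  finally have "AE x in lborel. (\<Sum>n. ennreal (norm (F n x))) \<noteq> \<infinity>"
    by (intro nn_integral_PInf_AE) auto
  then have ae: "AE x in lborel. summable (\<lambda>n. norm (F n x))"
    by eventually_elim (auto intro: summable_suminf_not_top)
  have sums: "(\<lambda>n. integral\<^sup>L lborel (F n)) sums (\<integral>x. (\<Sum>n. F n x) \<partial>lborel)"
    using summable_integral[OF F ae summ] integral_suminf[OF F ae summ] by (simp add: sums_iff)
  have "(\<integral>x. (\<Sum>n. F n x) \<partial>lborel) = (LINT x|lborel. cnj (\<Sum>n. cnj (b n) * of_real (hermite_fun n x))
      * f x)"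
  proof (rule integral_cong_AE)
    show "AE x in lborel. (\<Sum>n. F n x) = cnj (\<Sum>n. cnj (b n) * of_real (hermite_fun n x)) * f x"
      using ae
    proof eventually_elim
      case (elim x)
      show ?case
      \<comment> \<open>Summability is known for the terms that contain the factor
        \<open>f x\<close>. Where it is nonzero, division recovers the kernel series; where it
        vanishes, both sides are 0 whatever value \<open>suminf\<close> gives to the kernel.\<close>
      proof (cases "f x = 0")
        case False
        have "(\<lambda>n. F n x / f x) sums ((\<Sum>n. F n x) / f x)"
          by (intro sums_divide summable_sums summable_norm_cancel[OF elim])
        then have "(\<lambda>n. cnj (F n x / f x)) sums cnj ((\<Sum>n. F n x) / f x)" by (simp only: sums_cnj)
        moreover have "cnj (F n x / f x) = cnj (b n) * of_real (hermite_fun n x)" for n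
          using False by (simp add: F_def)
        ultimately have "(\<Sum>n. cnj (b n) * of_real (hermite_fun n x)) = cnj ((\<Sum>n. F n x) / f x)"
          by (simp add: sums_iff)
        then show ?thesis using False by simp
      qed (simp add: F_def)
    qed
  qed measurable
  moreover have "integral\<^sup>L lborel (F n) = b n * hermite_coeff f n" for n
    by (simp add: F_def[abs_def] hermite_coeff_def)
  ultimately show ?thesis using sums by simp
qed

lemma MLB_sums:
  assumes "q > 0"
  shows "(\<lambda>n. hermite_coeff (rep_L2 \<phi>) n * (z ^ n / of_real (mittag_weight q n))) sums MLB q \<phi> z"
proof -
  have "MLB q \<phi> z = (LINT x|lborel. cnj (\<Sum>n. cnj (z ^ n / of_real (mittag_weight q n)) * of_real
      (hermite_fun n x)) * rep_L2 \<phi> x)"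
    by (simp add: MLB_def MLB_kernel_def mittag_weight_def)
  with hermite_series_mult_sums[OF square_integrable_rep_L2 summable_mittag_weight[OF assms], of z
      \<phi>]
  show ?thesis by (simp add: mult.commute)
qed

section \<open>Power series and bijectivity of the transform\<close>

lemma power_series_coeff_unique:
  fixes a b :: "nat \<Rightarrow> complex"
  assumes a: "\<And>z. (\<lambda>n. a n * z ^ n) sums f z" and b: "\<And>z. (\<lambda>n. b n * z ^ n) sums f z"
  shows "a = b"
proof -
  have "fps_conv_radius (Abs_fps c) > 0" "eval_fps (Abs_fps c) z = f z"
      if "\<And>z. (\<lambda>n. c n * z ^ n) sums f z" for c z
  proof -
    have "conv_radius c = \<infinity>"
      by (rule conv_radius_inftyI'') (use that in \<open>auto intro: sums_summable\<close>)
    then show "fps_conv_radius (Abs_fps c) > 0" by (simp add: fps_conv_radius_def)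
    show "eval_fps (Abs_fps c) z = f z" using that[of z] by (simp add: eval_fps_def sums_iff)
  qed
  from this[OF a] this[OF b] have "Abs_fps a = Abs_fps b"
    by (intro eval_fps_eqD) auto
  then show ?thesis by (simp add: fps_eq_iff fun_eq_iff)
qed

text \<open>Coordinates in the normalised monomials turn the weighted condition into plain square
  summability, which is the form that Hermite coefficients satisfy. In the converse direction
  holomorphy comes from termwise differentiation of an everywhere convergent series.\<close>

lemma mittag_leffler_space_iff:
  assumes q: "q > 0"
  shows "f \<in> mittag_leffler_space q \<longleftrightarrow>
    (\<exists>c. summable (\<lambda>n. (cmod (c n))\<^sup>2) \<and> (\<forall>z. (\<lambda>n. c n * (z ^ n / of_real (mittag_weight q n)))
        sums f z))"
    (is "_ \<longleftrightarrow> (\<exists>c. ?P c)")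
proof
  have w: "mittag_weight q n > 0" "(mittag_weight q n)\<^sup>2 = Gamma (q * real n + 1)" for n
  proof -
    show "mittag_weight q n > 0" using q by (rule mittag_weight_pos)
    then show "(mittag_weight q n)\<^sup>2 = Gamma (q * real n + 1)" by (simp add: mittag_weight_def)
  qed
  {
    assume "f \<in> mittag_leffler_space q"
    then obtain a where a: "\<And>z. (\<lambda>n. a n * z ^ n)
        sums f z" "summable (\<lambda>n. Gamma (q * real n + 1) * (cmod (a n))\<^sup>2)"
      by (auto simp: mittag_leffler_space_def)
    have "?P (\<lambda>n. of_real (mittag_weight q n) * a n)"
      using a w less_imp_neq[OF w(1)] by (simp add: norm_mult power_mult_distrib)
    then show "\<exists>c. ?P c" by (rule exI[of _ "\<lambda>n. of_real (mittag_weight q n) * a n"])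
  }
  assume "\<exists>c. ?P c"
  then obtain c where c: "summable (\<lambda>n. (cmod (c n))\<^sup>2)" "\<And>z. (\<lambda>n. c n * (z ^ n / of_real
      (mittag_weight q n))) sums f z"
    by blast
  define a where "a n = c n / of_real (mittag_weight q n)" for n
  have a: "(\<lambda>n. a n * z ^ n) sums f z" for z using c(2)[of z] by (simp add: a_def)
  have "summable (\<lambda>n. Gamma (q * real n + 1) * (cmod (a n))\<^sup>2)"
    using c(1) less_imp_neq[OF w(1)] by (simp add: a_def norm_divide power_divide flip: w(2))
  moreover have "f holomorphic_on UNIV"
  proof -
    have "f = (\<lambda>z. \<Sum>n. a n * z ^ n)" using a by (simp add: sums_iff fun_eq_iff)
    moreover have "((\<lambda>z. \<Sum>n. a n * z ^ n) has_field_derivative (\<Sum>n. diffs a n * z ^ n)) (at z)"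
        for z
      by (rule termdiffs_strong_converges_everywhere) (use a in \<open>auto intro: sums_summable\<close>)
    ultimately show ?thesis by (auto simp: holomorphic_on_open)
  qed
  ultimately show "f \<in> mittag_leffler_space q" using a by (auto simp: mittag_leffler_space_def)
qed

lemma mittag_weight_coeff_unique:
  assumes q: "q > 0"
    and c: "\<And>z. (\<lambda>n. c n * (z ^ n / of_real (mittag_weight q n))) sums f z"
    and d: "\<And>z. (\<lambda>n. d n * (z ^ n / of_real (mittag_weight q n))) sums f z"
  shows "c n = (d n :: complex)"
proof -
  have "(\<lambda>n. c n / of_real (mittag_weight q n)) = (\<lambda>n. d n / of_real (mittag_weight q n))"
    by (rule power_series_coeff_unique[where f=f]) (use c d in auto)
  from fun_cong[OF this, of n] show ?thesis using mittag_weight_pos[OF q, of n] by simp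
qed

lemma inj_MLB:
  assumes q: "q > 0"
  shows "inj (MLB q)"
proof (rule injI)
  fix \<phi> \<psi> assume eq: "MLB q \<phi> = MLB q \<psi>"
  show "\<phi> = \<psi>"
    by (rule L2_eqI_hermite_coeff, rule mittag_weight_coeff_unique[OF q MLB_sums[OF q]])
      (unfold eq, rule MLB_sums[OF q])
qed

lemma range_MLB:
  assumes q: "q > 0"
  shows "range (MLB q) = mittag_leffler_space q"
proof (intro equalityI subsetI)
  fix f assume "f \<in> range (MLB q)"
  then show "f \<in> mittag_leffler_space q"
    unfolding mittag_leffler_space_iff[OF q]
    using MLB_sums[OF q] summable_hermite_coeff[OF square_integrable_rep_L2] by blast
next
  fix f assume "f \<in> mittag_leffler_space q"
  then obtain c where c: "summable (\<lambda>n. (cmod (c n))\<^sup>2)" "\<And>z. (\<lambda>n. c n * (z ^ n / of_real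
      (mittag_weight q n))) sums f z"
    unfolding mittag_leffler_space_iff[OF q] by blast
  obtain g where g: "square_integrable g" "\<And>n. hermite_coeff g n = c n"
    using hermite_Riesz_Fischer[OF c(1)] by blast
  have "MLB q (abs_L2 g) z = f z" for z
    using MLB_sums[OF q, of "abs_L2 g" z] c(2)[of z] g
      by (simp add: hermite_coeff_rep_abs_L2 sums_iff)
  then have "f = MLB q (abs_L2 g)" by auto
  then show "f \<in> range (MLB q)" by simp
qed

lemma MLB_fourier_L2:
  assumes q: "q > 0"
  shows "MLB q (fourier_L2 \<phi>) z = MLB q \<phi> (- \<i> * z)"
proof (rule sums_unique2)
  have "(- \<i>) ^ n * c * (z ^ n / w) = c * ((- \<i> * z) ^ n / w)" for n and c w :: complex
    by (subst power_mult_distrib) (simp add: mult_ac)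
  with MLB_sums[OF q, of "fourier_L2 \<phi>" z]
  show "(\<lambda>n. hermite_coeff (rep_L2 \<phi>) n * ((- \<i> * z) ^ n / of_real (mittag_weight q n)))
      sums MLB q (fourier_L2 \<phi>) z"
    by (simp only: hermite_coeff_fourier_L2)
qed (rule MLB_sums[OF q])

theorem theorem4p2:
  fixes q :: real
  assumes "q > 0"
  shows "bij_betw (MLB q) UNIV (mittag_leffler_space q)
    \<and> MLB_fourier q \<in> mittag_leffler_space q \<rightarrow> mittag_leffler_space q
    \<and> (\<forall>\<phi>. MLB_fourier q (MLB q \<phi>) = MLB q (fourier_L2 \<phi>))
    \<and> (\<forall>f \<in> mittag_leffler_space q. \<forall>z. MLB_fourier q f z = f (- \<i> * z))"
proof (intro conjI allI ballI)
  \<comment> \<open>Injectivity cancels \<open>inv (MLB q)\<close> against \<open>MLB q\<close>.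
    Every element of the space has the form \<open>MLB q \<phi>\<close>, so this equation determines
    the operator there.\<close>
  have *: "MLB_fourier q (MLB q \<phi>) = MLB q (fourier_L2 \<phi>)" for \<phi>
    by (simp add: MLB_fourier_def inv_f_f[OF inj_MLB[OF assms]])
  show "MLB_fourier q (MLB q \<phi>) = MLB q (fourier_L2 \<phi>)" for \<phi> by (rule *)
  show "bij_betw (MLB q) UNIV (mittag_leffler_space q)"
    using inj_MLB[OF assms] range_MLB[OF assms] by (simp add: bij_betw_def)
  show "MLB_fourier q \<in> mittag_leffler_space q \<rightarrow> mittag_leffler_space q"
    by (auto simp: * simp flip: range_MLB[OF assms])
  show "MLB_fourier q f z = f (- \<i> * z)" if "f \<in> mittag_leffler_space q" for f z
    using that by (auto simp: * MLB_fourier_L2[OF assms] simp flip: range_MLB[OF assms])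
qed

end
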